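(* For $\mathbf{P}_{\alpha}$-almost every $\mathbf{T}$, $$n^{\frac{1}{\alpha}}\,\mathbb{P}_{\mathbf{T}}(|\mathcal{C}|>n)\longrightarrow K_{\alpha}\mathbf{W}\qquad\text{as } n\to\infty .$$
   Context: Let $\alpha\in(1,2]$. $\mathbf{T}$ is a Galton--Watson tree with root $\rho$ and law $\mathbf{P}_\alpha$, whose offspring distribution is supported on $\{1,2,\ldots\}$, has mean $\mu\in(1,\infty)$, and satisfies one of: (a) $\alpha=2$ and the offspring distribution has finite variance $\sigma^2$; (b) $\alpha\in(1,2)$ and there is $c\in(0,\infty)$ such that $\mathbf{P}_\alpha(|\mathbf{T}_1|\ge x)\sim c x^{-\alpha}$ as $x\to\infty$. Here $\mathbf{T}_n$ is the set of vertices at generation $n$ of $\mathbf{T}$, and $\mathbf{W}=\lim_{n\to\infty}|\mathbf{T}_n|/\mu^n$ (the limit exists $\mathbf{P}_\alpha$-a.s.). Conditionally on $\mathbf{T}$, $\mathbb{P}_{\mathbf{T}}$ is the (quenched) law of Bernoulli bond percolation on $\mathbf{T}$ with parameter $1/\mu$ (the almost sure critical value), and $\mathcal{C}$ is the percolation cluster of $\rho$; $|\mathcal{C}|$ is its number of vertices. The annealed law is $\mathbb{P}_\alpha(\cdot)=\mathbf{E}_\alpha[\mathbb{P}_{\mathbf{T}}(\cdot)]$, where $\mathbf{E}_\alpha$ is expectation with respect to $\mathbf{P}_\alpha$; under it $\mathcal{C}$ is a critical Galton--Watson tree. $K_\alpha\in(0,\infty)$ is the constant (known to exist) such that $n^{1/\alpha}\mathbb{P}_\alpha(|\mathcal{C}|>n)\to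 K_\alpha$ as $n\to\infty$. *)

theory Defs
  imports "HOL-Probability.Probability" "HOL-Library.Landau_Symbols"
begin

text \<open>
  Rooted trees are sets of words over the naturals (Ulam--Harris labelling): the root is the
  empty word and the children of \<open>u\<close> are the words \<open>u @ [i]\<close>. Given a number \<open>N u\<close> of children
  for every word \<open>u\<close>, the resulting tree consists of the words all of whose letters are
  admissible.
\<close>

type_synonym vertex = "nat list"

definition tree_of_offspring :: "(vertex \<Rightarrow> nat) \<Rightarrow> vertex set" where
  "tree_of_offspring N = {v. \<forall>k < length v. v ! k < N (take k v)}"

definition tree_space :: "vertex set measure" where
  "tree_space = sigma UNIV (range (\<lambda>v. {T. v \<in> T}))"

definition GW_law :: "nat pmf \<Rightarrow> vertex set measure" where
  "GW_law p = distr (PiM UNIV (\<lambda>_. measure_pmf p)) tree_space tree_of_offspring"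

definition generation :: "vertex set \<Rightarrow> nat \<Rightarrow> vertex set" where
  "generation T n = {v \<in> T. length v = n}"

definition offspring_mean :: "nat pmf \<Rightarrow> real" where
  "offspring_mean p = measure_pmf.expectation p real"

text \<open>
  The generations of a tree are finite under \<open>GW_law p\<close>, so the cardinality is the true one.
\<close>

definition GW_limit :: "real \<Rightarrow> vertex set \<Rightarrow> real" where
  "GW_limit \<mu> T = lim (\<lambda>n. real (card (generation T n)) / \<mu> ^ n)"

definition edges :: "vertex set \<Rightarrow> vertex set set" where
  "edges T = {{u, u @ [i]} | u i. u \<in> T \<and> u @ [i] \<in> T}"

definition bond_percolation :: "real \<Rightarrow> vertex set \<Rightarrow> (vertex set \<Rightarrow> bool) measure" where
  "bond_percolation q T = PiM (edges T) (\<lambda>_. measure_pmf (bernoulli_pmf q))"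

definition open_adj :: "vertex set \<Rightarrow> (vertex set \<Rightarrow> bool) \<Rightarrow> vertex \<Rightarrow> vertex \<Rightarrow> bool" where
  "open_adj T \<omega> u v \<longleftrightarrow> {u, v} \<in> edges T \<and> \<omega> {u, v}"

definition root_cluster :: "vertex set \<Rightarrow> (vertex set \<Rightarrow> bool) \<Rightarrow> vertex set" where
  "root_cluster T \<omega> = {v. (open_adj T \<omega>)\<^sup>*\<^sup>* [] v}"

text \<open>
  The quenched probability of \<open>|C| > n\<close>. An infinite cluster has size greater than every \<open>n\<close>,
  whereas \<^const>\<open>card\<close> would give it the value 0.
\<close>

definition quenched_tail :: "real \<Rightarrow> vertex set \<Rightarrow> nat \<Rightarrow> real" where
  "quenched_tail q T n = measure (bond_percolation q T)
     {\<omega> \<in> space (bond_percolation q T).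
        infinite (root_cluster T \<omega>) \<or> n < card (root_cluster T \<omega>)}"

definition annealed_tail :: "nat pmf \<Rightarrow> real \<Rightarrow> nat \<Rightarrow> real" where
  "annealed_tail p q n = (\<integral>T. quenched_tail q T n \<partial>GW_law p)"

text \<open>
  The offspring assumption for index \<open>\<alpha>\<close>: finite variance if \<open>\<alpha> = 2\<close>, and a tail of
  \<open>|T\<^sub>1|\<close> asymptotic to \<open>c x\<^sup>-\<^sup>\<alpha>\<close> (with real \<open>x\<close>) if \<open>\<alpha> < 2\<close>.
\<close>

definition offspring_in_class :: "real \<Rightarrow> nat pmf \<Rightarrow> bool" where
  "offspring_in_class \<alpha> p \<longleftrightarrow>
     \<alpha> = 2 \<and> integrable (measure_pmf p) (\<lambda>k. (real k - offspring_mean p)\<^sup>2) \<or>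
     1 < \<alpha> \<and> \<alpha> < 2 \<and>
       (\<exists>c>0. (\<lambda>x::real. measure (GW_law p) {T. x \<le> real (card (generation T 1))})
                \<sim>[at_top] (\<lambda>x. c * x powr (- \<alpha>)))"

text \<open>
  Measurability of the tree map and of the event \<open>|C| > n\<close>: \<^const>\<open>distr\<close> and \<^const>\<open>measure\<close>
  do not fall back to their default values in \<^const>\<open>GW_law\<close> and \<^const>\<open>quenched_tail\<close>.
\<close>

lemma space_tree_space [simp]: "space tree_space = UNIV"
  by (simp add: tree_space_def)

lemma measurable_tree_of_offspring [measurable]:
  "tree_of_offspring \<in> measurable (PiM UNIV (\<lambda>_. measure_pmf p)) tree_space"
proof -
  let ?M = "PiM UNIV (\<lambda>_::vertex. measure_pmf p)"
  have "tree_of_offspring \<in> measurable ?M (sigma UNIV (range (\<lambda>v. {T. v \<in> T})))"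
  proof (rule measurable_measure_of)
    fix A :: "vertex set set"
    assume "A \<in> range (\<lambda>v. {T. v \<in> T})"
    then obtain v where A: "A = {T. v \<in> T}"
      by auto
    have [measurable]: "(\<lambda>N. N u) \<in> measurable ?M (count_space UNIV)" for u
      using measurable_component_singleton[of u UNIV "\<lambda>_. measure_pmf p"] by simp
    have "tree_of_offspring -` A \<inter> space ?M =
          {N \<in> space ?M. \<forall>k \<in> {..<length v}. v ! k < N (take k v)}"
      by (auto simp: A tree_of_offspring_def)
    also have "\<dots> \<in> sets ?M"
      by measurable
    finally show "tree_of_offspring -` A \<inter> space ?M \<in> sets ?M" .
  qed auto
  then show ?thesis
    by (simp add: tree_space_def)
qed

lemma prob_space_GW_law: "prob_space (GW_law p)"
  unfolding GW_law_def
  by (intro prob_space.prob_space_distr measurable_tree_of_offspring prob_space_PiM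
      measure_pmf.prob_space_axioms)

lemma prob_space_bond_percolation: "prob_space (bond_percolation q T)"
  unfolding bond_percolation_def by (intro prob_space_PiM measure_pmf.prob_space_axioms)

lemma sets_cluster_exceeds:
  "{\<omega> \<in> space (bond_percolation q T).
      infinite (root_cluster T \<omega>) \<or> n < card (root_cluster T \<omega>)} \<in> sets (bond_percolation q T)"
proof -
  let ?B = "bond_percolation q T"
  have adj [measurable]: "Measurable.pred ?B (\<lambda>\<omega>. open_adj T \<omega> u v)" for u v
  proof (cases "{u, v} \<in> edges T")
    case True
    then have "(\<lambda>\<omega>. \<omega> {u, v}) \<in> measurable ?B (measure_pmf (bernoulli_pmf q))"
      unfolding bond_percolation_def by (rule measurable_component_singleton)
    with True show ?thesis
      by (simp add: open_adj_def)
  qed (simp add: open_adj_def)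
  have [measurable]: "Measurable.pred ?B (\<lambda>\<omega>. (open_adj T \<omega> ^^ m) u v)" for m u v
  proof (induction m arbitrary: v)
    case (Suc m)
    note Suc [measurable]
    show ?case
      unfolding relpowp.simps relcompp_apply by measurable
  qed simp
  have [measurable]: "Measurable.pred ?B (\<lambda>\<omega>. v \<in> root_cluster T \<omega>)" for v
    unfolding root_cluster_def mem_Collect_eq rtranclp_power by measurable
  have exceeds_iff: "infinite C \<or> n < card C \<longleftrightarrow>
      (\<exists>xs. (distinct xs \<and> length xs = Suc n) \<and> (\<forall>v \<in> set xs. v \<in> C))" for C :: "vertex set"
  proof
    assume "infinite C \<or> n < card C"
    then obtain F where "F \<subseteq> C" "card F = Suc n" "finite F"
      by (meson Suc_leI infinite_arbitrarily_large obtain_subset_with_card_n)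
    then show "\<exists>xs. (distinct xs \<and> length xs = Suc n) \<and> (\<forall>v \<in> set xs. v \<in> C)"
      by (metis distinct_card finite_distinct_list subsetD)
  next
    assume "\<exists>xs. (distinct xs \<and> length xs = Suc n) \<and> (\<forall>v \<in> set xs. v \<in> C)"
    then show "infinite C \<or> n < card C"
      by (metis Suc_le_eq card_mono distinct_card subsetI)
  qed
  show ?thesis
    unfolding exceeds_iff by measurable
qed

end

(*
  The percolation probabilities Q_n(T) = P_T(|C| > n) are compared with the branching average
  L Q_n(T), the mean over the children of the root, weighted by 1 / mu, of Q_n of their subtrees. Both
  dominate g = 1 - prod_i (1 - Q_n(T_i) / mu), and both have the annealed mean a_n, so that
  E|Q_n - L Q_n| <= 2 (a_n - E g) <= C a_n^beta as soon as the offspring law has a moment of order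
  beta in (1, 2]. As L is an L^1 contraction, E|Q_n - L^m Q_n| <= C m a_n^beta.
  On the other hand, L^m Q_n is mu^-m times a sum of |T_m| independent copies of Q_n, so
  a second moment bound gives E|L^m Q_n - a_n W_m| <= sqrt (a_n / mu^m) with W_m = |T_m| / mu^m.
  Along n = k^D with m = k and D large, the errors divided by a_n are summable, which gives almost
  sure convergence of Q_n / a_n to W; monotonicity in n fills the gaps because (k + 1)^D / k^D -> 1.
*)
theory Submission
  imports Defs "HOL-Real_Asymp.Real_Asymp"
begin

section \<open>Functions of disjoint blocks of coordinates\<close>

text \<open>Offspring numbers are attached to all words, so that the subtrees of the children of the
  root are disjoint blocks of i.i.d. coordinates and the branching property becomes a statement
  about product measures. The gap a_n - E g is the mean defect of that union bound, and this is
  where the moment enters: beta is 2 for finite variance, but under a tail of order x^(-\<alpha>)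
  the moment of order \<alpha> is infinite, whence some beta in (1, \<alpha>). The depth m obeys two
  opposing constraints: m a_n^(beta - 1) must be small while a_n mu^m must be large. As a_n decays
  polynomially, a small power of n is a suitable depth, and the sparse sequence of indices makes the
  errors summable as well.\<close>

lemma indep_vars_PiM_components:
  assumes "\<And>i. i \<in> I \<Longrightarrow> prob_space (M i)"
  shows "prob_space.indep_vars (PiM I M) M (\<lambda>i \<omega>. \<omega> i) I"
proof (cases "I = {}")
  case False
  interpret prob_space "PiM I M"
    by (intro prob_space_PiM assms)
  have "distr (PiM I M) (PiM I M) (\<lambda>x. \<lambda>i\<in>I. x i) = distr (PiM I M) (PiM I M) (\<lambda>x. x)"
    by (intro distr_cong) (auto simp: space_PiM PiE_def extensional_restrict)
  also have "\<dots> = PiM I (\<lambda>i. distr (PiM I M) (M i) (\<lambda>x. x i))"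
    using assms by (auto simp: distr_id distr_PiM_component intro!: PiM_cong)
  finally show ?thesis
    using False by (subst indep_vars_iff_distr_eq_PiM') auto
next
  case True
  interpret prob_space "PiM I M"
    by (intro prob_space_PiM assms)
  show ?thesis
    unfolding indep_vars_def indep_sets_def using True by simp
qed

text \<open>Functions of disjoint blocks are independent. Each block is the injective image of its
  own index set under \<open>r j\<close>, so that \<open>g j\<close> can live on the product space
  of a smaller copy: the offspring numbers of a subtree, or the edges of a subtree before
  grafting.\<close>

lemma
  fixes M :: "'i \<Rightarrow> 'a measure" and r :: "'j \<Rightarrow> 'b \<Rightarrow> 'i" and g :: "'j \<Rightarrow> ('b \<Rightarrow> 'a) \<Rightarrow> real"
  assumes M: "\<And>i. i \<in> I \<Longrightarrow> prob_space (M i)"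
    and J: "finite J"
    and inj: "\<And>j. j \<in> J \<Longrightarrow> inj_on (r j) (A j)"
    and sub: "\<And>j. j \<in> J \<Longrightarrow> r j ` A j \<subseteq> I"
    and disj: "disjoint_family_on (\<lambda>j. r j ` A j) J"
    and int: "\<And>j. j \<in> J \<Longrightarrow> integrable (PiM (A j) (\<lambda>a. M (r j a))) (g j)"
  shows integral_PiM_disjoint_blocks:
      "(\<integral>\<omega>. (\<Prod>j\<in>J. g j (\<lambda>a\<in>A j. \<omega> (r j a))) \<partial>PiM I M) =
       (\<Prod>j\<in>J. \<integral>x. g j x \<partial>PiM (A j) (\<lambda>a. M (r j a)))" (is ?eq)
    and integrable_PiM_disjoint_blocks:
      "integrable (PiM I M) (\<lambda>\<omega>. \<Prod>j\<in>J. g j (\<lambda>a\<in>A j. \<omega> (r j a)))" (is ?integrable)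
proof -
  interpret prob_space "PiM I M"
    by (intro prob_space_PiM M)
  let ?R = "\<lambda>j \<omega>. \<lambda>a\<in>A j. \<omega> (r j a)"
  let ?N = "\<lambda>j. PiM (A j) (\<lambda>a. M (r j a))"
  have R: "?R j \<in> measurable (PiM L M) (?N j)" if "j \<in> J" "r j ` A j \<subseteq> L" for j L
    using that by (intro measurable_restrict measurable_component_singleton) auto
  have distr: "distr (PiM I M) (?N j) (?R j) = ?N j" if "j \<in> J" for j
    using M inj[OF that] sub[OF that] by (intro distr_PiM_reindex) auto
  have gR: "integrable (PiM I M) (\<lambda>\<omega>. g j (?R j \<omega>))"
    "(\<integral>\<omega>. g j (?R j \<omega>) \<partial>PiM I M) = integral\<^sup>L (?N j) (g j)" if "j \<in> J" for j
  proof -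
    have g: "g j \<in> borel_measurable (?N j)"
      using int[OF that] by simp
    show "integrable (PiM I M) (\<lambda>\<omega>. g j (?R j \<omega>))"
      using integrable_distr_eq[OF R[OF that sub[OF that]] g] distr[OF that] int[OF that] by simp
    show "(\<integral>\<omega>. g j (?R j \<omega>) \<partial>PiM I M) = integral\<^sup>L (?N j) (g j)"
      using integral_distr[OF R[OF that sub[OF that]] g] distr[OF that] by simp
  qed
  have "indep_vars (\<lambda>j. PiM (r j ` A j) M) (\<lambda>j \<omega>. restrict \<omega> (r j ` A j)) J"
    using indep_vars_restrict[OF indep_vars_PiM_components[OF M] sub disj] by simp
  moreover have "(\<lambda>\<omega>. g j (?R j \<omega>)) \<in> borel_measurable (PiM (r j ` A j) M)" if "j \<in> J" for j
    using int[OF that] by (intro measurable_compose[OF R[OF that order_refl]]) simp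
  ultimately have "indep_vars (\<lambda>_. borel) (\<lambda>j \<omega>. g j (?R j (restrict \<omega> (r j ` A j)))) J"
    by (rule indep_vars_compose2)
  moreover have "?R j (restrict \<omega> (r j ` A j)) = ?R j \<omega>" for j and \<omega> :: "'i \<Rightarrow> 'a"
    by auto
  ultimately have ind: "indep_vars (\<lambda>_. borel) (\<lambda>j \<omega>. g j (?R j \<omega>)) J"
    by simp
  show ?integrable
    by (rule indep_vars_integrable[OF J ind gR(1)])
  show ?eq
    using indep_vars_lebesgue_integral[OF J ind gR(1)] gR(2) by simp
qed

section \<open>The branching property\<close>

definition offspring_space :: "nat pmf \<Rightarrow> (vertex \<Rightarrow> nat) measure" where
  "offspring_space p = PiM UNIV (\<lambda>_. measure_pmf p)"

definition subtree_offspring :: "nat \<Rightarrow> (vertex \<Rightarrow> nat) \<Rightarrow> vertex \<Rightarrow> nat" where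
  "subtree_offspring i N = (\<lambda>u. N (i # u))"

text \<open>The weight is 1 / \<open>\<mu>\<close> and not 1 / \<open>N []\<close>: this preserves
  annealed means and makes the iterates of the constant 1 the normalized generation sizes.\<close>

definition branch_avg :: "real \<Rightarrow> ((vertex \<Rightarrow> nat) \<Rightarrow> real) \<Rightarrow> (vertex \<Rightarrow> nat) \<Rightarrow> real" where
  "branch_avg \<mu> f N = (\<Sum>i<N []. f (subtree_offspring i N)) / \<mu>"

lemma prob_space_offspring_space: "prob_space (offspring_space p)"
  unfolding offspring_space_def by (intro prob_space_PiM measure_pmf.prob_space_axioms)

lemma measurable_offspring_eval [measurable]:
  "(\<lambda>N. N u) \<in> measurable (offspring_space p) (count_space UNIV)"
  using measurable_component_singleton[of u UNIV "\<lambda>_. measure_pmf p"]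
  by (simp add: offspring_space_def)

lemma measurable_subtree_offspring [measurable]:
  "subtree_offspring i \<in> measurable (offspring_space p) (offspring_space p)"
  using measurable_offspring_eval[of _ p] unfolding offspring_space_def subtree_offspring_def
  by (intro measurable_PiM_single') (auto simp: space_PiM)

lemma measurable_branch_avg [measurable]:
  assumes [measurable]: "f \<in> borel_measurable (offspring_space p)"
  shows "branch_avg \<mu> f \<in> borel_measurable (offspring_space p)"
proof -
  \<comment> \<open>The number of summands is random; freezing it at each of the countably many
    values of \<open>N []\<close> leaves sums of fixed length.\<close>
  have "(\<lambda>N. (\<lambda>k N. (\<Sum>i<k. f (subtree_offspring i N)) / \<mu>) (N []) N) \<in> borel_measurable (offspring_space p)"
    by (rule measurable_compose_countable) measurable
  then show ?thesis
    by (simp add: branch_avg_def[abs_def])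
qed

text \<open>The root coordinate and the subtrees of distinct children occupy disjoint blocks of
  words. \<open>I\<close> is fixed in advance and may contain indices beyond \<open>N []\<close>,
  since every word has an offspring number, in the tree or not.\<close>

lemma
  fixes h :: "nat \<Rightarrow> real" and f :: "nat \<Rightarrow> (vertex \<Rightarrow> nat) \<Rightarrow> real"
  assumes h: "integrable (measure_pmf p) h" and I: "finite I"
    and f: "\<And>i. i \<in> I \<Longrightarrow> integrable (offspring_space p) (f i)"
  shows integral_branching:
      "(\<integral>N. h (N []) * (\<Prod>i\<in>I. f i (subtree_offspring i N)) \<partial>offspring_space p) =
       measure_pmf.expectation p h * (\<Prod>i\<in>I. \<integral>N. f i N \<partial>offspring_space p)"
    and integrable_branching:
      "integrable (offspring_space p) (\<lambda>N. h (N []) * (\<Prod>i\<in>I. f i (subtree_offspring i N)))"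
proof -
  define A :: "nat option \<Rightarrow> vertex set" where
    "A j = (case j of None \<Rightarrow> {[]} | Some i \<Rightarrow> UNIV)" for j
  define r :: "nat option \<Rightarrow> vertex \<Rightarrow> vertex" where
    "r j = (case j of None \<Rightarrow> id | Some i \<Rightarrow> (#) i)" for j
  define g where "g j = (case j of None \<Rightarrow> (\<lambda>x::vertex \<Rightarrow> nat. h (x [])) | Some i \<Rightarrow> f i)" for j
  define J where "J = insert None (Some ` I)"
  have J: "finite J"
    using I by (simp add: J_def)
  have M: "prob_space (measure_pmf p)" for i :: vertex
    by (rule measure_pmf.prob_space_axioms)
  have inj: "inj_on (r j) (A j)" for j
    by (auto simp: r_def A_def inj_on_def split: option.splits)
  have disj: "disjoint_family_on (\<lambda>j. r j ` A j) J"
    by (auto simp: disjoint_family_on_def r_def A_def split: option.splits)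
  interpret root: product_sigma_finite "\<lambda>_::vertex. measure_pmf p"
    by standard
  have hm: "h \<in> borel_measurable (measure_pmf p)"
    by simp
  have "distr (PiM {[]::vertex} (\<lambda>_. measure_pmf p)) (measure_pmf p) (\<lambda>\<omega>. \<omega> []) = measure_pmf p"
    by (intro distr_PiM_component M) auto
  then have root_int: "integrable (PiM {[]::vertex} (\<lambda>_. measure_pmf p)) (\<lambda>x. h (x []))"
    using h integrable_distr_eq[OF _ hm, of "\<lambda>\<omega>. \<omega> []" "PiM {[]::vertex} (\<lambda>_. measure_pmf p)"]
      measurable_component_singleton[of "[]::vertex" "{[]}" "\<lambda>_. measure_pmf p"]
    by simp
  have int: "integrable (PiM (A j) (\<lambda>_. measure_pmf p)) (g j)" if "j \<in> J" for j
    using that f root_int by (auto simp: A_def g_def J_def offspring_space_def)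
  have eq: "(\<Prod>j\<in>J. g j (\<lambda>a\<in>A j. N (r j a))) = h (N []) * (\<Prod>i\<in>I. f i (subtree_offspring i N))" for N
    using I by (simp add: J_def g_def A_def r_def prod.reindex subtree_offspring_def restrict_def)
  show "integrable (offspring_space p) (\<lambda>N. h (N []) * (\<Prod>i\<in>I. f i (subtree_offspring i N)))"
    using integrable_PiM_disjoint_blocks[of UNIV "\<lambda>_. measure_pmf p" J r A g] M J inj disj int
    by (simp add: eq offspring_space_def)
  have "(\<integral>N. h (N []) * (\<Prod>i\<in>I. f i (subtree_offspring i N)) \<partial>offspring_space p) =
      (\<Prod>j\<in>J. \<integral>x. g j x \<partial>PiM (A j) (\<lambda>_. measure_pmf p))"
    using integral_PiM_disjoint_blocks[of UNIV "\<lambda>_. measure_pmf p" J r A g] M J inj disj int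
    by (simp add: eq offspring_space_def)
  also have "\<dots> = measure_pmf.expectation p h * (\<Prod>i\<in>I. \<integral>N. f i N \<partial>offspring_space p)"
    using I root.product_integral_singleton[OF hm, of "[]"]
    by (simp add: J_def g_def A_def prod.reindex offspring_space_def)
  finally show "(\<integral>N. h (N []) * (\<Prod>i\<in>I. f i (subtree_offspring i N)) \<partial>offspring_space p) =
    measure_pmf.expectation p h * (\<Prod>i\<in>I. \<integral>N. f i N \<partial>offspring_space p)" .
qed

text \<open>Conditioning on the root degree without conditional expectations: \<open>c k\<close>
  plays the mean of \<open>G\<close> given \<open>N [] = k\<close>. The sum over k is exchanged with
  the integral by monotone convergence, whence the sign condition on \<open>G\<close>.\<close>

lemma
  fixes G :: "(vertex \<Rightarrow> nat) \<Rightarrow> real" and c :: "nat \<Rightarrow> real"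
  assumes G [measurable]: "G \<in> borel_measurable (offspring_space p)"
    and nonneg: "\<And>N. 0 \<le> G N"
    and c: "integrable (measure_pmf p) c"
    and int: "\<And>k. integrable (offspring_space p) (\<lambda>N. indicator {k} (N []) * G N)"
    and eq: "\<And>k. (\<integral>N. indicator {k} (N []) * G N \<partial>offspring_space p) = pmf p k * c k"
  shows integrable_by_root_degree: "integrable (offspring_space p) G"
    and integral_by_root_degree: "(\<integral>N. G N \<partial>offspring_space p) = measure_pmf.expectation p c"
proof -
  \<comment> \<open>The sign of \<open>c k\<close> is forced only where \<open>p\<close> has mass;
    elsewhere \<open>c\<close> is arbitrary.\<close>
  have c_nonneg: "0 \<le> c k" if "k \<in> set_pmf p" for k
  proof -
    have "0 \<le> pmf p k * c k"
      unfolding eq[symmetric] using nonneg by (intro Bochner_Integration.integral_nonneg) auto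
    with that show ?thesis
      by (simp add: zero_le_mult_iff pmf_eq_0_set_pmf)
  qed
  have pc_nonneg: "0 \<le> pmf p k * c k" for k
    using c_nonneg[of k] by (cases "pmf p k = 0") (auto simp: set_pmf_iff)
  have c_AE: "AE k in measure_pmf p. 0 \<le> c k"
    by (simp add: AE_measure_pmf_iff c_nonneg)
  have split: "ennreal (G N) = (\<Sum>k. ennreal (indicator {k} (N []) * G N))" for N
    by (subst suminf_finite[of "{N []}"]) (auto simp: indicator_def)
  have "(\<integral>\<^sup>+N. G N \<partial>offspring_space p) =
      (\<Sum>k. \<integral>\<^sup>+N. ennreal (indicator {k} (N []) * G N) \<partial>offspring_space p)"
    unfolding split using borel_measurable_integrable[OF int] by (intro nn_integral_suminf) auto
  also have "\<dots> = (\<Sum>k. ennreal (pmf p k * c k))"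
    using nn_integral_eq_integral[OF int] nonneg eq by simp
  also have "\<dots> = (\<integral>\<^sup>+k. c k \<partial>measure_pmf p)"
    by (simp add: nn_integral_measure_pmf nn_integral_count_space_nat ennreal_mult' ennreal_mult'')
  also have "\<dots> = ennreal (measure_pmf.expectation p c)"
    using c c_AE by (rule nn_integral_eq_integral)
  finally have *: "(\<integral>\<^sup>+N. G N \<partial>offspring_space p) = ennreal (measure_pmf.expectation p c)" .
  show "integrable (offspring_space p) G"
    using * nonneg by (intro integrableI_nonneg) auto
  show "(\<integral>N. G N \<partial>offspring_space p) = measure_pmf.expectation p c"
    using * nonneg integral_nonneg_AE[OF c_AE] by (intro integral_eq_nn_integral[THEN trans]) auto
qed

lemma branch_avg_diff: "branch_avg \<mu> (\<lambda>N. f N - g N) N = branch_avg \<mu> f N - branch_avg \<mu> g N"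
  by (simp add: branch_avg_def sum_subtractf diff_divide_distrib)

lemma branch_avg_cmult: "branch_avg \<mu> (\<lambda>N. c * f N) N = c * branch_avg \<mu> f N"
  by (simp add: branch_avg_def sum_distrib_left)

lemma abs_branch_avg_le:
  assumes "0 \<le> \<mu>"
  shows "\<bar>branch_avg \<mu> f N\<bar> \<le> branch_avg \<mu> (\<lambda>N. \<bar>f N\<bar>) N"
  using assms by (auto simp: branch_avg_def abs_divide intro!: divide_right_mono sum_abs)

lemma measurable_branch_avg_iter [measurable]:
  "f \<in> borel_measurable (offspring_space p) \<Longrightarrow>
    (branch_avg \<mu> ^^ m) f \<in> borel_measurable (offspring_space p)"
  by (induction m) auto

lemma branch_avg_iter_diff:
  "(branch_avg \<mu> ^^ m) (\<lambda>N. f N - g N) = (\<lambda>N. (branch_avg \<mu> ^^ m) f N - (branch_avg \<mu> ^^ m) g N)"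
  by (induction m) (auto simp: branch_avg_diff)

lemma branch_avg_iter_cmult:
  "(branch_avg \<mu> ^^ m) (\<lambda>N. c * f N) = (\<lambda>N. c * (branch_avg \<mu> ^^ m) f N)"
  by (induction m) (auto simp: branch_avg_cmult)

section \<open>The branching average on L^1 and L^2\<close>

locale GW_offspring =
  fixes p :: "nat pmf" and \<mu> :: real
  assumes integrable_offspring: "integrable (measure_pmf p) real"
    and mean: "\<mu> = offspring_mean p"
    and supercritical: "1 < \<mu>"
begin

abbreviation \<Omega> where "\<Omega> \<equiv> offspring_space p"

sublocale prob_space \<Omega>
  by (rule prob_space_offspring_space)

lemma integral_offspring: "measure_pmf.expectation p real = \<mu>"
  by (simp add: mean offspring_mean_def)

lemma integrable_indicator_pmf [simp]: "integrable (measure_pmf p) (indicator {k::nat} :: nat \<Rightarrow> real)"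
  by (rule measure_pmf.integrable_const_bound[where B = 1]) (auto simp: indicator_def)

lemma
  assumes f: "integrable \<Omega> f"
  shows integral_root_subtree:
      "(\<integral>N. indicator {k} (N []) * f (subtree_offspring i N) \<partial>\<Omega>) = pmf p k * (\<integral>N. f N \<partial>\<Omega>)"
    and integrable_root_subtree: "integrable \<Omega> (\<lambda>N. indicator {k} (N []) * f (subtree_offspring i N))"
  using integral_branching[of p "indicator {k}" "{i}" "\<lambda>_. f"]
    integrable_branching[of p "indicator {k}" "{i}" "\<lambda>_. f"] f
  by (auto simp: pmf.rep_eq)

text \<open>Given k children, the average has k summands of mean E f / \<open>\<mu>\<close>, and the
  mean of k is \<open>\<mu>\<close>.\<close>

lemma
  assumes f: "integrable \<Omega> f" and nonneg: "\<And>N. 0 \<le> f N"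
  shows integrable_branch_avg_nonneg: "integrable \<Omega> (branch_avg \<mu> f)"
    and integral_branch_avg_nonneg: "(\<integral>N. branch_avg \<mu> f N \<partial>\<Omega>) = (\<integral>N. f N \<partial>\<Omega>)"
proof -
  let ?c = "\<lambda>k. real k * ((\<integral>N. f N \<partial>\<Omega>) / \<mu>)"
  have [measurable]: "f \<in> borel_measurable \<Omega>"
    using f by simp
  have eq: "indicator {k} (N []) * branch_avg \<mu> f N =
      (\<Sum>i<k. indicator {k} (N []) * f (subtree_offspring i N)) / \<mu>" for k N
    by (auto simp: branch_avg_def indicator_def)
  have int: "integrable \<Omega> (\<lambda>N. indicator {k} (N []) * branch_avg \<mu> f N)" for k
    unfolding eq by (intro integrable_divide Bochner_Integration.integrable_sum integrable_root_subtree f)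
  have c: "(\<integral>N. indicator {k} (N []) * branch_avg \<mu> f N \<partial>\<Omega>) = pmf p k * ?c k" for k
    unfolding eq
    by (simp only: integral_divide_zero Bochner_Integration.integral_sum
        integrable_root_subtree[OF f] integral_root_subtree[OF f]) simp
  have "0 \<le> branch_avg \<mu> f N" for N
    using nonneg supercritical by (auto simp: branch_avg_def intro!: divide_nonneg_pos sum_nonneg)
  note root = integrable_by_root_degree[OF _ this _ int c] integral_by_root_degree[OF _ this _ int c]
  show "integrable \<Omega> (branch_avg \<mu> f)"
    using integrable_offspring by (intro root) auto
  have "(\<integral>N. branch_avg \<mu> f N \<partial>\<Omega>) = measure_pmf.expectation p ?c"
    using integrable_offspring by (intro root) auto
  then show "(\<integral>N. branch_avg \<mu> f N \<partial>\<Omega>) = (\<integral>N. f N \<partial>\<Omega>)"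
    using supercritical by (simp add: integral_offspring)
qed

lemma
  assumes f: "integrable \<Omega> f"
  shows integrable_branch_avg: "integrable \<Omega> (branch_avg \<mu> f)"
    and integral_branch_avg: "(\<integral>N. branch_avg \<mu> f N \<partial>\<Omega>) = (\<integral>N. f N \<partial>\<Omega>)"
    and integral_abs_branch_avg_le: "(\<integral>N. \<bar>branch_avg \<mu> f N\<bar> \<partial>\<Omega>) \<le> (\<integral>N. \<bar>f N\<bar> \<partial>\<Omega>)"
proof -
  \<comment> \<open>Positive and negative parts, because summation over the root degree is available
    for nonnegative functions.\<close>
  define f1 where "f1 N = max (f N) 0" for N
  define f2 where "f2 N = max (- f N) 0" for N
  have f12: "integrable \<Omega> f1" "integrable \<Omega> f2" "\<And>N. 0 \<le> f1 N" "\<And>N. 0 \<le> f2 N"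
    using f by (auto simp: f1_def[abs_def] f2_def[abs_def])
  have f_eq: "f = (\<lambda>N. f1 N - f2 N)"
    by (auto simp: f1_def f2_def max_def)
  note i1 = integrable_branch_avg_nonneg[OF f12(1,3)] integrable_branch_avg_nonneg[OF f12(2,4)]
  have eq: "branch_avg \<mu> f = (\<lambda>N. branch_avg \<mu> f1 N - branch_avg \<mu> f2 N)"
    by (subst f_eq) (auto simp: branch_avg_diff)
  show int: "integrable \<Omega> (branch_avg \<mu> f)"
    unfolding eq using i1 by auto
  show "(\<integral>N. branch_avg \<mu> f N \<partial>\<Omega>) = (\<integral>N. f N \<partial>\<Omega>)"
    unfolding eq using i1 f12
    by (subst f_eq) (simp add: integral_branch_avg_nonneg)
  have "(\<integral>N. \<bar>branch_avg \<mu> f N\<bar> \<partial>\<Omega>) \<le> (\<integral>N. branch_avg \<mu> (\<lambda>N. \<bar>f N\<bar>) N \<partial>\<Omega>)"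
    using f supercritical
    by (intro integral_mono integrable_abs[OF int] integrable_branch_avg_nonneg abs_branch_avg_le) simp_all
  also have "\<dots> = (\<integral>N. \<bar>f N\<bar> \<partial>\<Omega>)"
    using f by (intro integral_branch_avg_nonneg) auto
  finally show "(\<integral>N. \<bar>branch_avg \<mu> f N\<bar> \<partial>\<Omega>) \<le> (\<integral>N. \<bar>f N\<bar> \<partial>\<Omega>)" .
qed

lemma
  assumes f: "integrable \<Omega> f"
  shows integrable_branch_avg_iter: "integrable \<Omega> ((branch_avg \<mu> ^^ m) f)"
    and integral_branch_avg_iter: "(\<integral>N. (branch_avg \<mu> ^^ m) f N \<partial>\<Omega>) = (\<integral>N. f N \<partial>\<Omega>)"
    and integral_abs_branch_avg_iter_le:
      "(\<integral>N. \<bar>(branch_avg \<mu> ^^ m) f N\<bar> \<partial>\<Omega>) \<le> (\<integral>N. \<bar>f N\<bar> \<partial>\<Omega>)"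
proof (induction m)
  case (Suc m)
  { case 1 show ?case using Suc(1) by (simp add: integrable_branch_avg) }
  { case 2 show ?case using Suc(1,2) by (simp add: integral_branch_avg) }
  { case 3 show ?case using integral_abs_branch_avg_le[OF Suc(1)] Suc(3) by simp }
qed (use f in auto)

text \<open>Telescoping: f - L^m f is the sum of L^j (f - L f) over j < m, and every L^j is a
  contraction.\<close>

lemma integral_abs_diff_branch_avg_iter_le:
  assumes f: "integrable \<Omega> f"
  shows "(\<integral>N. \<bar>f N - (branch_avg \<mu> ^^ m) f N\<bar> \<partial>\<Omega>) \<le> m * (\<integral>N. \<bar>f N - branch_avg \<mu> f N\<bar> \<partial>\<Omega>)"
proof (induction m)
  case (Suc m)
  let ?L = "branch_avg \<mu>"
  note int = f integrable_branch_avg[OF f] integrable_branch_avg_iter[OF f]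
  have "(\<integral>N. \<bar>f N - (?L ^^ Suc m) f N\<bar> \<partial>\<Omega>) \<le>
      (\<integral>N. \<bar>f N - (?L ^^ m) f N\<bar> + \<bar>(?L ^^ m) f N - (?L ^^ m) (?L f) N\<bar> \<partial>\<Omega>)"
    using int(1,2) int(3)[of m] int(3)[of "Suc m"]
    by (intro integral_mono) (auto simp: funpow_Suc_right simp del: funpow.simps)
  also have "\<dots> = (\<integral>N. \<bar>f N - (?L ^^ m) f N\<bar> \<partial>\<Omega>) + (\<integral>N. \<bar>(?L ^^ m) (\<lambda>N. f N - ?L f N) N\<bar> \<partial>\<Omega>)"
    using int(1,2) int(3)[of m] int(3)[of "Suc m"]
    by (simp add: branch_avg_iter_diff funpow_Suc_right del: funpow.simps)
  also have "(\<integral>N. \<bar>(?L ^^ m) (\<lambda>N. f N - ?L f N) N\<bar> \<partial>\<Omega>) \<le> (\<integral>N. \<bar>f N - ?L f N\<bar> \<partial>\<Omega>)"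
    using int by (intro integral_abs_branch_avg_iter_le) auto
  finally show ?case
    using Suc by (simp add: algebra_simps)
qed simp

text \<open>Expand the square over pairs of children. Off-diagonal pairs are independent and
  centred, so given k children only k diagonal terms remain, each with weight 1 /
  \<open>\<mu>\<close>^2. Only the first moment of the offspring number enters, which keeps second
  moments usable for heavy-tailed offspring.\<close>

lemma
  assumes f: "integrable \<Omega> f" and f2: "integrable \<Omega> (\<lambda>N. (f N)\<^sup>2)" and centered: "(\<integral>N. f N \<partial>\<Omega>) = 0"
  shows integrable_branch_avg_square: "integrable \<Omega> (\<lambda>N. (branch_avg \<mu> f N)\<^sup>2)"
    and integral_branch_avg_square:
      "(\<integral>N. (branch_avg \<mu> f N)\<^sup>2 \<partial>\<Omega>) = (\<integral>N. (f N)\<^sup>2 \<partial>\<Omega>) / \<mu>"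
proof -
  let ?c = "\<lambda>k. real k * ((\<integral>N. (f N)\<^sup>2 \<partial>\<Omega>) / \<mu>\<^sup>2)"
  have [measurable]: "f \<in> borel_measurable \<Omega>"
    using f by simp
  have eq: "indicator {k} (N []) * (branch_avg \<mu> f N)\<^sup>2 =
      (\<Sum>i<k. \<Sum>j<k. indicator {k} (N []) * (f (subtree_offspring i N) * f (subtree_offspring j N))) / \<mu>\<^sup>2" for k N
    by (auto simp: branch_avg_def indicator_def power2_eq_square sum_product)
  have summand: "integrable \<Omega> (\<lambda>N. indicator {k} (N []) * (f (subtree_offspring i N) * f (subtree_offspring j N)))"
    (is "?I i j k")
    "(\<integral>N. indicator {k} (N []) * (f (subtree_offspring i N) * f (subtree_offspring j N)) \<partial>\<Omega>) =
      (if i = j then pmf p k * (\<integral>N. (f N)\<^sup>2 \<partial>\<Omega>) else 0)" (is "?E i j k") for i j k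
  proof -
    show "?I i j k"
    proof (cases "i = j")
      case True
      then show ?thesis
        using integrable_root_subtree[OF f2] by (simp add: power2_eq_square)
    next
      case False
      then show ?thesis
        using integrable_branching[of p "indicator {k}" "{i, j}" "\<lambda>_. f"] f by simp
    qed
    show "?E i j k"
    proof (cases "i = j")
      case True
      then show ?thesis
        using integral_root_subtree[OF f2] by (simp add: power2_eq_square)
    next
      case False
      then show ?thesis
        using integral_branching[of p "indicator {k}" "{i, j}" "\<lambda>_. f"] f centered by simp
    qed
  qed
  have int: "integrable \<Omega> (\<lambda>N. indicator {k} (N []) * (branch_avg \<mu> f N)\<^sup>2)" for k
    unfolding eq by (intro integrable_divide Bochner_Integration.integrable_sum summand)
  have c: "(\<integral>N. indicator {k} (N []) * (branch_avg \<mu> f N)\<^sup>2 \<partial>\<Omega>) = pmf p k * ?c k" for k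
    unfolding eq
    by (simp only: integral_divide_zero Bochner_Integration.integral_sum
        Bochner_Integration.integrable_sum summand) simp
  note root = integrable_by_root_degree[OF _ _ _ int c] integral_by_root_degree[OF _ _ _ int c]
  show "integrable \<Omega> (\<lambda>N. (branch_avg \<mu> f N)\<^sup>2)"
    using integrable_offspring by (intro root) auto
  have "(\<integral>N. (branch_avg \<mu> f N)\<^sup>2 \<partial>\<Omega>) = measure_pmf.expectation p ?c"
    using integrable_offspring by (intro root) auto
  then show "(\<integral>N. (branch_avg \<mu> f N)\<^sup>2 \<partial>\<Omega>) = (\<integral>N. (f N)\<^sup>2 \<partial>\<Omega>) / \<mu>"
    using supercritical by (simp add: integral_offspring power2_eq_square)
qed

lemma
  assumes f: "integrable \<Omega> f" and f2: "integrable \<Omega> (\<lambda>N. (f N)\<^sup>2)" and centered: "(\<integral>N. f N \<partial>\<Omega>) = 0"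
  shows integrable_branch_avg_iter_square: "integrable \<Omega> (\<lambda>N. ((branch_avg \<mu> ^^ m) f N)\<^sup>2)"
    and integral_branch_avg_iter_square:
      "(\<integral>N. ((branch_avg \<mu> ^^ m) f N)\<^sup>2 \<partial>\<Omega>) = (\<integral>N. (f N)\<^sup>2 \<partial>\<Omega>) / \<mu> ^ m"
proof (induction m)
  case (Suc m)
  note Lm = integrable_branch_avg_iter[OF f, of m] Suc(1)
    integral_branch_avg_iter[OF f, of m, unfolded centered]
  { case 1 show ?case using integrable_branch_avg_square[OF Lm] by simp }
  { case 2 show ?case using integral_branch_avg_square[OF Lm] Suc(2) by simp }
qed (use f2 in auto)

text \<open>Cauchy-Schwarz, read off from the nonnegative variance of |f|.\<close>

lemma integral_abs_le_sqrt:
  assumes "integrable \<Omega> f" and "integrable \<Omega> (\<lambda>N. (f N)\<^sup>2)"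
  shows "(\<integral>N. \<bar>f N\<bar> \<partial>\<Omega>) \<le> sqrt (\<integral>N. (f N)\<^sup>2 \<partial>\<Omega>)"
proof -
  have "0 \<le> variance (\<lambda>N. \<bar>f N\<bar>)"
    by (intro variance_positive)
  also have "\<dots> = (\<integral>N. (f N)\<^sup>2 \<partial>\<Omega>) - (\<integral>N. \<bar>f N\<bar> \<partial>\<Omega>)\<^sup>2"
    using assms by (subst variance_eq) auto
  finally show ?thesis
    by (intro real_le_rsqrt) simp
qed

text \<open>The square estimate is applied to f minus its mean a. The operator does not fix
  constants: m averagings turn a into a |T_m| / mu^m, which is therefore what L^m f is compared
  with.\<close>

lemma integral_abs_branch_avg_iter_centered_le:
  assumes f: "integrable \<Omega> f" and f2: "integrable \<Omega> (\<lambda>N. (f N)\<^sup>2)"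
  shows "(\<integral>N. \<bar>(branch_avg \<mu> ^^ m) f N - (\<integral>N. f N \<partial>\<Omega>) * (branch_avg \<mu> ^^ m) (\<lambda>_. 1) N\<bar> \<partial>\<Omega>)
    \<le> sqrt ((\<integral>N. (f N)\<^sup>2 \<partial>\<Omega>) / \<mu> ^ m)"
proof -
  define a where "a = (\<integral>N. f N \<partial>\<Omega>)"
  define g where "g N = f N - a" for N
  have g: "integrable \<Omega> g" "(\<integral>N. g N \<partial>\<Omega>) = 0"
    using f by (auto simp: g_def[abs_def] a_def prob_space)
  have g2: "integrable \<Omega> (\<lambda>N. (g N)\<^sup>2)"
    using f f2 by (simp add: g_def power2_diff)
  have "(branch_avg \<mu> ^^ m) g = (\<lambda>N. (branch_avg \<mu> ^^ m) f N - a * (branch_avg \<mu> ^^ m) (\<lambda>_. 1) N)"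
    using branch_avg_iter_cmult[of m \<mu> a "\<lambda>_. 1"]
    unfolding g_def[abs_def] by (simp add: branch_avg_iter_diff)
  then have "(\<integral>N. \<bar>(branch_avg \<mu> ^^ m) f N - a * (branch_avg \<mu> ^^ m) (\<lambda>_. 1) N\<bar> \<partial>\<Omega>) =
      (\<integral>N. \<bar>(branch_avg \<mu> ^^ m) g N\<bar> \<partial>\<Omega>)"
    by simp
  also have "\<dots> \<le> sqrt (\<integral>N. ((branch_avg \<mu> ^^ m) g N)\<^sup>2 \<partial>\<Omega>)"
    by (intro integral_abs_le_sqrt integrable_branch_avg_iter integrable_branch_avg_iter_square g g2)
  also have "\<dots> = sqrt ((\<integral>N. (g N)\<^sup>2 \<partial>\<Omega>) / \<mu> ^ m)"
    by (simp add: integral_branch_avg_iter_square g g2)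
  also have "(\<integral>N. (g N)\<^sup>2 \<partial>\<Omega>) = (\<integral>N. (f N)\<^sup>2 \<partial>\<Omega>) - a\<^sup>2"
    using variance_eq[OF f f2] by (simp add: g_def a_def)
  also have "sqrt (((\<integral>N. (f N)\<^sup>2 \<partial>\<Omega>) - a\<^sup>2) / \<mu> ^ m) \<le> sqrt ((\<integral>N. (f N)\<^sup>2 \<partial>\<Omega>) / \<mu> ^ m)"
    using supercritical by (intro real_sqrt_le_mono divide_right_mono) auto
  finally show ?thesis
    by (simp add: a_def)
qed

end

section \<open>Percolation on subtrees\<close>

lemma Nil_in_tree_of_offspring [simp]: "[] \<in> tree_of_offspring N"
  by (simp add: tree_of_offspring_def)

lemma Cons_in_tree_of_offspring:
  "i # u \<in> tree_of_offspring N \<longleftrightarrow> i < N [] \<and> u \<in> tree_of_offspring (subtree_offspring i N)"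
  by (auto simp: tree_of_offspring_def subtree_offspring_def less_Suc_eq_0_disj)

definition cluster_exceeds :: "vertex set \<Rightarrow> nat \<Rightarrow> (vertex set \<Rightarrow> bool) \<Rightarrow> bool" where
  "cluster_exceeds T n \<omega> \<longleftrightarrow> infinite (root_cluster T \<omega>) \<or> n < card (root_cluster T \<omega>)"

lemma measurable_cluster_exceeds [measurable]:
  "Measurable.pred (bond_percolation q T) (cluster_exceeds T n)"
  using sets_cluster_exceeds[of q T n] by (simp add: pred_def cluster_exceeds_def)

lemma integrable_cluster_exceeds:
  "integrable (bond_percolation q T) (\<lambda>\<omega>. of_bool (cluster_exceeds T n \<omega>) :: real)"
  and integral_cluster_exceeds:
  "(\<integral>\<omega>. of_bool (cluster_exceeds T n \<omega>) \<partial>bond_percolation q T) = quenched_tail q T n"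
proof -
  interpret prob_space "bond_percolation q T"
    by (rule prob_space_bond_percolation)
  let ?E = "{\<omega> \<in> space (bond_percolation q T). cluster_exceeds T n \<omega>}"
  show "integrable (bond_percolation q T) (\<lambda>\<omega>. of_bool (cluster_exceeds T n \<omega>) :: real)"
    by (rule integrable_const_bound[where B = 1]) auto
  have "(\<integral>\<omega>. of_bool (cluster_exceeds T n \<omega>) \<partial>bond_percolation q T) = 
      (\<integral>\<omega>. indicator ?E \<omega> \<partial>bond_percolation q T :: real)"
    by (intro Bochner_Integration.integral_cong) auto
  also have "\<dots> = quenched_tail q T n"
    by (auto simp: quenched_tail_def cluster_exceeds_def intro!: arg_cong[where f = prob])
  finally show "(\<integral>\<omega>. of_bool (cluster_exceeds T n \<omega>) \<partial>bond_percolation q T) = quenched_tail q T n" .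
qed

lemma quenched_tail_nonneg: "0 \<le> quenched_tail q T n"
  by (simp add: quenched_tail_def)

lemma quenched_tail_le_1: "quenched_tail q T n \<le> 1"
  unfolding quenched_tail_def
  by (rule prob_space.prob_le_1[OF prob_space_bond_percolation])

lemma quenched_tail_antimono:
  assumes "m \<le> n"
  shows "quenched_tail q T n \<le> quenched_tail q T m"
proof -
  interpret prob_space "bond_percolation q T"
    by (rule prob_space_bond_percolation)
  show ?thesis
    unfolding quenched_tail_def using assms sets_cluster_exceeds
    by (intro finite_measure_mono) auto
qed

definition graft_edge :: "nat \<Rightarrow> vertex set \<Rightarrow> vertex set" where
  "graft_edge i e = (#) i ` e"

lemma inj_graft_edge: "inj_on (graft_edge i) E"
  by (auto simp: graft_edge_def inj_on_def inj_image_eq_iff)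

lemma graft_edge_in_edges:
  assumes "(#) i ` S \<subseteq> T" and "e \<in> edges S"
  shows "graft_edge i e \<in> edges T"
proof -
  obtain u j where "e = {u, u @ [j]}" "u \<in> S" "u @ [j] \<in> S"
    using assms(2) by (auto simp: edges_def)
  then have "graft_edge i e = {i # u, (i # u) @ [j]}" "i # u \<in> T" "(i # u) @ [j] \<in> T"
    using assms(1) by (auto simp: graft_edge_def)
  then show ?thesis
    unfolding edges_def by blast
qed

text \<open>Once the edge from the root to \<open>[i]\<close> is open, open paths of the subtree
  lift by prefixing \<open>i\<close>. The pulled-back configuration is restricted to
  \<open>edges S\<close> because the points of the product space over these edges are
  extensional.\<close>

lemma root_cluster_graft:
  assumes T: "[] \<in> T" "[i] \<in> T" "(#) i ` S \<subseteq> T" and \<omega>: "\<omega> {[], [i]}"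
  shows "(#) i ` root_cluster S (\<lambda>e\<in>edges S. \<omega> (graft_edge i e)) \<subseteq> root_cluster T \<omega>"
proof -
  let ?\<omega>' = "\<lambda>e\<in>edges S. \<omega> (graft_edge i e)"
  have "{[], [i]} \<in> edges T"
    unfolding edges_def using T(1,2) by force
  then have "(open_adj T \<omega>)\<^sup>*\<^sup>* [] [i]"
    using \<omega> by (auto simp: open_adj_def)
  moreover have "(open_adj T \<omega>)\<^sup>*\<^sup>* [i] (i # v)" if "(open_adj S ?\<omega>')\<^sup>*\<^sup>* [] v" for v
    using that
  proof (induction rule: rtranclp_induct)
    case (step u v)
    then have "graft_edge i {u, v} \<in> edges T" "\<omega> (graft_edge i {u, v})"
      using graft_edge_in_edges[OF T(3)] by (auto simp: open_adj_def)
    then have "open_adj T \<omega> (i # u) (i # v)"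
      by (simp add: open_adj_def graft_edge_def)
    with step.IH show ?case
      by (rule rtranclp.rtrancl_into_rtrancl)
  qed simp
  ultimately show ?thesis
    by (auto simp: root_cluster_def intro: rtranclp_trans)
qed

lemma cluster_exceeds_graft:
  assumes "[] \<in> T" "[i] \<in> T" "(#) i ` S \<subseteq> T" "\<omega> {[], [i]}"
    and "cluster_exceeds S n (\<lambda>e\<in>edges S. \<omega> (graft_edge i e))"
  shows "cluster_exceeds T n \<omega>"
proof (cases "finite (root_cluster T \<omega>)")
  case True
  let ?C = "root_cluster S (\<lambda>e\<in>edges S. \<omega> (graft_edge i e))"
  have sub: "(#) i ` ?C \<subseteq> root_cluster T \<omega>"
    using assms(1-4) by (rule root_cluster_graft)
  have "finite ?C"
    using finite_subset[OF sub True] by (simp add: finite_image_iff)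
  moreover have "card ?C \<le> card (root_cluster T \<omega>)"
    using card_mono[OF True sub] by (simp add: card_image)
  ultimately show ?thesis
    using assms(5) by (auto simp: cluster_exceeds_def)
qed (simp add: cluster_exceeds_def)

text \<open>It suffices that one child, joined to the root by an open edge, has a large cluster of
  its own. For different children these events read disjoint sets of edges, so their failures are
  independent; joint contributions of several children are given up.\<close>

lemma quenched_tail_ge_graft:
  assumes q: "0 \<le> q" "q \<le> 1" and I: "finite I" and "[] \<in> T"
    and T: "\<And>i. i \<in> I \<Longrightarrow> [i] \<in> T" "\<And>i. i \<in> I \<Longrightarrow> (#) i ` S i \<subseteq> T"
  shows "1 - (\<Prod>i\<in>I. 1 - q * quenched_tail q (S i) n) \<le> quenched_tail q T n"
proof -
  let ?B = "\<lambda>_::vertex set. measure_pmf (bernoulli_pmf q)"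
  \<comment> \<open>\<open>K i\<close> collects the edges that concern child \<open>i\<close>, and
    \<open>Y i\<close> indicates that the edge to \<open>i\<close> is open and the cluster inside
    its subtree is large.\<close>
  define K where "K i = insert {[], [i]} (graft_edge i ` edges (S i))" for i
  define Y :: "nat \<Rightarrow> (vertex set \<Rightarrow> bool) \<Rightarrow> real" where
    "Y i x = of_bool (x {[], [i]}) *
       of_bool (cluster_exceeds (S i) n (\<lambda>e\<in>edges (S i). x (graft_edge i e)))" for i x
  interpret P: prob_space "bond_percolation q T"
    by (rule prob_space_bond_percolation)
  have B: "prob_space (?B e)" for e
    by (rule measure_pmf.prob_space_axioms)
  \<comment> \<open>All grafts agree on the empty set, so disjointness of the \<open>K i\<close>
    rests on edges being nonempty.\<close>
  have nonempty: "e \<noteq> {}" if "e \<in> edges (S i)" for e and i :: nat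
    using that by (auto simp: edges_def)
  have root_edge: "{[], [i]} \<in> edges T" if "i \<in> I" for i :: nat
    unfolding edges_def using T(1)[OF that] \<open>[] \<in> T\<close> by force
  have not_root_edge: "{[], [i]} \<noteq> graft_edge j e" for i j :: nat and e
    by (auto simp: graft_edge_def)
  have K_sub: "K i \<subseteq> edges T" if "i \<in> I" for i :: nat
    using root_edge[OF that] graft_edge_in_edges[OF T(2)[OF that]] by (auto simp: K_def)
  have graft_neq: "graft_edge i e \<noteq> graft_edge j e'" if "i \<noteq> j" "e \<noteq> {}" for i j :: nat and e e'
    using that by (auto simp: graft_edge_def)
  have root_neq: "{[], [i]} \<noteq> {[], [j]}" if "i \<noteq> j" for i j :: nat
    using that by (auto simp: doubleton_eq_iff)
  have K_disj: "disjoint_family_on K I"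
    unfolding disjoint_family_on_def
  proof (intro ballI impI equals0I)
    fix i j x assume ij: "i \<noteq> j" and x: "x \<in> K i \<inter> K j"
    then consider "x = {[], [i]}" | e where "x = graft_edge i e" "e \<in> edges (S i)"
      unfolding K_def by blast
    then show False
    proof cases
      case 1
      then show ?thesis
        using x root_neq[OF ij] not_root_edge unfolding K_def by (metis IntE imageE insertE)
    next
      case 2
      then show ?thesis
        using x graft_neq[OF ij nonempty] not_root_edge unfolding K_def by (metis IntE imageE insertE)
    qed
  qed
  have Y: "integrable (PiM (K i) ?B) (Y i)"
    "(\<integral>x. Y i x \<partial>PiM (K i) ?B) = q * quenched_tail q (S i) n" for i :: nat
  proof -
    \<comment> \<open>Within one child, the root edge (\<open>False\<close>) and the grafted subtree
      (\<open>True\<close>) are again two disjoint blocks; their independence gives the factor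
      \<open>q\<close>.\<close>
    let ?A = "\<lambda>b. if b then edges (S i) else {{[], [i]}}"
    let ?r = "\<lambda>b. if b then graft_edge i else id"
    let ?g = "\<lambda>b x. if b then of_bool (cluster_exceeds (S i) n x) else of_bool (x {[], [i]}) :: real"
    interpret e: product_sigma_finite ?B
      by standard
    have int: "integrable (PiM (?A b) ?B) (?g b)" for b
      using integrable_cluster_exceeds[of q "S i" n] B
        measurable_component_singleton[of "{[], [i]}" "{{[], [i]}}" ?B]
      by (auto simp: bond_percolation_def intro!: finite_measure.integrable_const_bound[where B = 1]
          prob_space.finite_measure prob_space_PiM)
    have eq: "(\<Prod>b\<in>UNIV. ?g b (\<lambda>a\<in>?A b. x (?r b a))) = Y i x" for x
      by (simp add: UNIV_bool Y_def)
    have sub: "?r b ` ?A b \<subseteq> K i" for b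
      by (auto simp: K_def)
    have disj: "disjoint_family_on (\<lambda>b. ?r b ` ?A b) UNIV"
      using not_root_edge by (auto simp: disjoint_family_on_def)
    have inj: "inj_on (?r b) (?A b)" for b
      by (simp add: inj_graft_edge)
    note blocks = integral_PiM_disjoint_blocks[of "K i" ?B UNIV ?r ?A ?g, OF B finite inj sub disj int]
      integrable_PiM_disjoint_blocks[of "K i" ?B UNIV ?r ?A ?g, OF B finite inj sub disj int]
    show "integrable (PiM (K i) ?B) (Y i)"
      using blocks(2) by (simp only: eq)
    have "(\<integral>x. of_bool (x {[], [i]}) \<partial>PiM {{[], [i]}} ?B) = (q::real)"
      using e.product_integral_singleton[of "of_bool :: bool \<Rightarrow> real" "{[], [i]}"] q by simp
    then show "(\<integral>x. Y i x \<partial>PiM (K i) ?B) = q * quenched_tail q (S i) n"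
      using blocks(1) integral_cluster_exceeds[where q = q and T = "S i" and n = n]
      by (simp only: eq) (simp add: UNIV_bool bond_percolation_def mult.commute)
  qed
  have inj: "inj_on id (K i)" for i :: nat by simp
  have sub: "id ` K i \<subseteq> edges T" if "i \<in> I" for i :: nat using K_sub[OF that] by simp
  have disj: "disjoint_family_on (\<lambda>i. id ` K i) I" using K_disj by simp
  have int: "integrable (PiM (K i) ?B) (\<lambda>x. 1 - Y i x)" for i :: nat
    using Y(1) B by (intro Bochner_Integration.integrable_diff finite_measure.integrable_const
        prob_space.finite_measure prob_space_PiM)
  have restr: "Y i (restrict \<omega> (K i)) = Y i \<omega>" for i :: nat and \<omega>
  proof -
    have "(\<lambda>e\<in>edges (S i). (restrict \<omega> (K i)) (graft_edge i e)) = (\<lambda>e\<in>edges (S i). \<omega> (graft_edge i e))"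
      by (rule restrict_ext) (simp add: K_def)
    then show ?thesis
      by (simp add: Y_def K_def)
  qed
  have int_prod: "integrable (bond_percolation q T) (\<lambda>\<omega>. \<Prod>i\<in>I. 1 - Y i \<omega>)"
    using integrable_PiM_disjoint_blocks[of "edges T" ?B I "\<lambda>_. id" K "\<lambda>i x. 1 - Y i x", OF B I inj sub disj int]
    by (simp add: restr bond_percolation_def)
  have "1 - quenched_tail q T n = (\<integral>\<omega>. 1 - of_bool (cluster_exceeds T n \<omega>) \<partial>bond_percolation q T)"
    using integrable_cluster_exceeds integral_cluster_exceeds[where q = q and T = T and n = n] P.prob_space
    by simp
  also have "\<dots> \<le> (\<integral>\<omega>. (\<Prod>i\<in>I. 1 - Y i \<omega>) \<partial>bond_percolation q T)"
  proof (intro integral_mono int_prod Bochner_Integration.integrable_diff integrable_cluster_exceeds)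
    fix \<omega>
    have "Y i \<omega> = 0" if "i \<in> I" "\<not> cluster_exceeds T n \<omega>" for i
      using cluster_exceeds_graft[OF \<open>[] \<in> T\<close> T[OF that(1)], of \<omega> n] that(2) by (auto simp: Y_def)
    moreover have "0 \<le> (\<Prod>i\<in>I. 1 - Y i \<omega>)"
      by (intro prod_nonneg) (auto simp: Y_def)
    ultimately show "1 - of_bool (cluster_exceeds T n \<omega>) \<le> (\<Prod>i\<in>I. 1 - Y i \<omega>)"
      by (cases "cluster_exceeds T n \<omega>") auto
  qed simp
  also have "\<dots> = (\<Prod>i\<in>I. \<integral>x. 1 - Y i x \<partial>PiM (K i) ?B)"
    using integral_PiM_disjoint_blocks[of "edges T" ?B I "\<lambda>_. id" K "\<lambda>i x. 1 - Y i x", OF B I inj sub disj int]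
    by (simp add: restr bond_percolation_def)
  also have "\<dots> = (\<Prod>i\<in>I. 1 - q * quenched_tail q (S i) n)"
  proof (intro prod.cong refl)
    fix i :: nat
    interpret K: prob_space "PiM (K i) ?B"
      by (intro prob_space_PiM B)
    show "(\<integral>x. 1 - Y i x \<partial>PiM (K i) ?B) = 1 - q * quenched_tail q (S i) n"
      using Y K.prob_space by simp
  qed
  finally show ?thesis
    by simp
qed

lemma quenched_tail_tree_ge:
  assumes "0 \<le> q" "q \<le> 1"
  shows "1 - (\<Prod>i<N []. 1 - q * quenched_tail q (tree_of_offspring (subtree_offspring i N)) n)
    \<le> quenched_tail q (tree_of_offspring N) n"
  using assms by (intro quenched_tail_ge_graft) (auto simp: Cons_in_tree_of_offspring)

text \<open>Splitting words by their first letter matches the recursion of the operator at the root.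
  Finiteness is carried along since \<open>card\<close> adds up over disjoint blocks only when they
  are finite.\<close>

lemma card_generation_tree:
  assumes "\<mu> \<noteq> 0"
  shows "finite (generation (tree_of_offspring N) m) \<and>
    real (card (generation (tree_of_offspring N) m)) / \<mu> ^ m = (branch_avg \<mu> ^^ m) (\<lambda>_. 1) N"
proof (induction m arbitrary: N)
  case 0
  have "generation (tree_of_offspring N) 0 = {[]}"
    by (auto simp: generation_def)
  then show ?case by simp
next
  case (Suc m)
  let ?G = "\<lambda>i. generation (tree_of_offspring (subtree_offspring i N)) m"
  have G: "generation (tree_of_offspring N) (Suc m) = (\<Union>i<N []. (#) i ` ?G i)"
  proof (rule set_eqI)
    fix v :: vertex
    show "v \<in> generation (tree_of_offspring N) (Suc m) \<longleftrightarrow> v \<in> (\<Union>i<N []. (#) i ` ?G i)"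
      by (cases v) (auto simp: generation_def Cons_in_tree_of_offspring)
  qed
  have "card (\<Union>i<N []. (#) i ` ?G i) = (\<Sum>i<N []. card ((#) i ` ?G i))"
    using Suc by (intro card_UN_disjoint) auto
  also have "\<dots> = (\<Sum>i<N []. card (?G i))"
    by (simp add: card_image)
  finally have "real (card (generation (tree_of_offspring N) (Suc m))) / \<mu> ^ Suc m =
      (\<Sum>i<N []. real (card (?G i)) / \<mu> ^ m) / \<mu>"
    unfolding G by (simp add: sum_divide_distrib mult.commute)
  also have "\<dots> = (branch_avg \<mu> ^^ Suc m) (\<lambda>_. 1) N"
    using Suc by (simp add: branch_avg_def[of \<mu> "(branch_avg \<mu> ^^ m) (\<lambda>_. 1)" N])
  finally show ?case
    unfolding G using Suc by auto
qed

section \<open>Moment estimates\<close>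

text \<open>The sum of the absolute values has finite mean, so it is almost surely finite. This
  serves in place of a Borel-Cantelli argument, both for the increments of |T_m| / mu^m and for the
  errors along the subsequence.\<close>

lemma AE_summable_of_summable_integral_abs:
  fixes f :: "nat \<Rightarrow> 'a \<Rightarrow> real"
  assumes int: "\<And>n. integrable M (f n)" and sum: "summable (\<lambda>n. \<integral>x. \<bar>f n x\<bar> \<partial>M)"
  shows "AE x in M. summable (\<lambda>n. \<bar>f n x\<bar>)"
proof -
  have [measurable]: "f n \<in> borel_measurable M" for n
    using int by simp
  have "(\<integral>\<^sup>+x. (\<Sum>n. ennreal \<bar>f n x\<bar>) \<partial>M) = (\<Sum>n. \<integral>\<^sup>+x. ennreal \<bar>f n x\<bar> \<partial>M)"
    by (rule nn_integral_suminf) measurable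
  also have "\<dots> = (\<Sum>n. ennreal (\<integral>x. \<bar>f n x\<bar> \<partial>M))"
    using int by (simp add: nn_integral_eq_integral)
  also have "\<dots> = ennreal (\<Sum>n. \<integral>x. \<bar>f n x\<bar> \<partial>M)"
    using sum by (intro suminf_ennreal2) auto
  finally have "(\<integral>\<^sup>+x. (\<Sum>n. ennreal \<bar>f n x\<bar>) \<partial>M) \<noteq> \<infinity>"
    by simp
  then have "AE x in M. (\<Sum>n. ennreal \<bar>f n x\<bar>) \<noteq> \<infinity>"
    by (intro nn_integral_PInf_AE) auto
  then show ?thesis
    by eventually_elim (intro summable_suminf_not_top, auto)
qed

lemma convergent_of_summable_abs_diff:
  fixes X :: "nat \<Rightarrow> real"
  assumes "summable (\<lambda>n. \<bar>X (Suc n) - X n\<bar>)"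
  shows "convergent X"
proof -
  have "convergent (\<lambda>m. \<Sum>n<m. X (Suc n) - X n)"
    using summable_rabs_cancel[OF assms] by (simp add: summable_iff_convergent)
  then have "convergent (\<lambda>m. X m - X 0)"
    by (simp add: sum_lessThan_telescope)
  then show ?thesis
    using convergent_add[OF _ convergent_const[of "X 0"]] by fastforce
qed

text \<open>The left side is at most s^2 for small s and at most s for large s; a power between 1
  and 2 covers both regimes.\<close>

lemma linear_minus_one_plus_exp_le:
  fixes s \<beta> :: real
  assumes "0 \<le> s" "1 \<le> \<beta>" "\<beta> \<le> 2"
  shows "s - 1 + exp (- s) \<le> s powr \<beta>"
proof (cases "s \<le> 1")
  case True
  have "exp (- s) \<le> 1 / (1 + s)"
    using assms(1) exp_ge_add_one_self[of s] by (simp add: exp_minus inverse_eq_divide frac_le)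
  also have "\<dots> \<le> 1 - s + s\<^sup>2"
    using assms(1) by (simp add: field_simps power2_eq_square)
  finally have "s - 1 + exp (- s) \<le> s powr 2"
    using assms(1) by (cases "s = 0") auto
  also have "\<dots> \<le> s powr \<beta>"
    using True assms by (intro powr_mono')
  finally show ?thesis .
next
  case False
  then have "s - 1 + exp (- s) \<le> s powr 1"
    by simp
  also have "\<dots> \<le> s powr \<beta>"
    using False assms by (intro powr_mono) auto
  finally show ?thesis .
qed

text \<open>The left side is the excess of the union bound over the probability that at least one of
  k independent events of probability \<open>y\<close> occurs.\<close>

lemma union_bound_defect_le:
  fixes y \<beta> :: real
  assumes "0 \<le> y" "y \<le> 1" "1 \<le> \<beta>" "\<beta> \<le> 2"
  shows "real k * y - 1 + (1 - y) ^ k \<le> (real k * y) powr \<beta>"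
proof -
  have "(1 - y) ^ k \<le> exp (- y) ^ k"
    using assms exp_ge_add_one_self[of "- y"] by (intro power_mono) auto
  also have "\<dots> = exp (- (real k * y))"
    by (simp add: exp_of_nat_mult[symmetric])
  finally show ?thesis
    using linear_minus_one_plus_exp_le[of "real k * y" \<beta>] assms by simp
qed

context GW_offspring
begin

text \<open>Given the root degree the factors are independent, which produces the generating
  function of \<open>p\<close> at the mean of \<open>h\<close>.\<close>

lemma integral_prod_subtrees:
  fixes h :: "(vertex \<Rightarrow> nat) \<Rightarrow> real"
  assumes [measurable]: "h \<in> borel_measurable \<Omega>" and h: "\<And>N. 0 \<le> h N" "\<And>N. h N \<le> 1"
  shows "integrable \<Omega> (\<lambda>N. \<Prod>i<N []. h (subtree_offspring i N))"
    and "(\<integral>N. (\<Prod>i<N []. h (subtree_offspring i N)) \<partial>\<Omega>) =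
      measure_pmf.expectation p (\<lambda>k. (\<integral>N. h N \<partial>\<Omega>) ^ k)"
proof -
  let ?G = "\<lambda>N. \<Prod>i<N []. h (subtree_offspring i N)"
  have int_h: "integrable \<Omega> h"
    using h by (intro integrable_const_bound[where B = 1]) auto
  have h_bounds: "0 \<le> (\<integral>N. h N \<partial>\<Omega>)" "(\<integral>N. h N \<partial>\<Omega>) \<le> 1"
    using h integral_le_const[OF int_h, of 1] by auto
  have "(\<lambda>N. (\<lambda>k N. \<Prod>i<k. h (subtree_offspring i N)) (N []) N) \<in> borel_measurable \<Omega>"
    by (rule measurable_compose_countable) measurable
  then have G: "?G \<in> borel_measurable \<Omega>"
    by simp
  have G_nonneg: "0 \<le> ?G N" for N
    using h by (intro prod_nonneg) auto
  have c: "integrable (measure_pmf p) (\<lambda>k. (\<integral>N. h N \<partial>\<Omega>) ^ k)"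
    using h_bounds by (intro measure_pmf.integrable_const_bound[where B = 1]) (auto simp: power_le_one)
  have eq: "indicator {k} (N []) * ?G N =
      indicator {k} (N []) * (\<Prod>i<k. h (subtree_offspring i N))" for k N
    by (auto simp: indicator_def)
  have int: "integrable \<Omega> (\<lambda>N. indicator {k} (N []) * ?G N)" for k
    unfolding eq using integrable_branching[of p "indicator {k}" "{..<k}" "\<lambda>_. h"] int_h by simp
  have val: "(\<integral>N. indicator {k} (N []) * ?G N \<partial>\<Omega>) = pmf p k * (\<integral>N. h N \<partial>\<Omega>) ^ k" for k
    unfolding eq using integral_branching[of p "indicator {k}" "{..<k}" "\<lambda>_. h"] int_h
    by (simp add: pmf.rep_eq)
  show "integrable \<Omega> ?G"
    by (rule integrable_by_root_degree[OF G G_nonneg c int val])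
  show "(\<integral>N. ?G N \<partial>\<Omega>) = measure_pmf.expectation p (\<lambda>k. (\<integral>N. h N \<partial>\<Omega>) ^ k)"
    by (rule integral_by_root_degree[OF G G_nonneg c int val])
qed

end

section \<open>L^1 estimates from an offspring moment of order \<open>\<beta>\<close>\<close>

locale GW_moment = GW_offspring +
  fixes \<beta> :: real
  assumes beta: "1 < \<beta>" "\<beta> \<le> 2"
    and integrable_moment: "integrable (measure_pmf p) (\<lambda>k. real k powr \<beta>)"
begin

definition normalized_moment :: real where
  "normalized_moment = measure_pmf.expectation p (\<lambda>k. (real k / \<mu>) powr \<beta>)"

lemma integrable_normalized_moment: "integrable (measure_pmf p) (\<lambda>k. (real k / \<mu>) powr \<beta>)"
  using integrable_moment supercritical by (simp add: powr_divide)

lemma normalized_moment_nonneg: "0 \<le> normalized_moment"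
  unfolding normalized_moment_def by (intro Bochner_Integration.integral_nonneg) simp

text \<open>
  Both \<open>f\<close> and its branching average dominate \<open>g = 1 - (\<Prod>i. 1 - f (subtree_offspring i N) / \<mu>)\<close>
  and both have the same mean, so their distance in \<open>L\<^sup>1\<close> is controlled by
  the gap between that mean and the mean of \<open>g\<close>.
\<close>

lemma integral_abs_diff_branch_avg_le:
  assumes [measurable]: "f \<in> borel_measurable \<Omega>"
    and f: "\<And>N. 0 \<le> f N" "\<And>N. f N \<le> 1"
    and ge: "\<And>N. 1 - (\<Prod>i<N []. 1 - f (subtree_offspring i N) / \<mu>) \<le> f N"
  shows "(\<integral>N. \<bar>f N - branch_avg \<mu> f N\<bar> \<partial>\<Omega>) \<le> 2 * normalized_moment * (\<integral>N. f N \<partial>\<Omega>) powr \<beta>"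
proof -
  let ?h = "\<lambda>N. 1 - f N / \<mu>"
  define a where "a = (\<integral>N. f N \<partial>\<Omega>)"
  define g where "g N = 1 - (\<Prod>i<N []. ?h (subtree_offspring i N))" for N
  have int_f: "integrable \<Omega> f"
    using f by (intro integrable_const_bound[where B = 1]) auto
  have a: "0 \<le> a" "a \<le> 1"
    using f integral_le_const[OF int_f, of 1] by (auto simp: a_def)
  have f_le: "f N / \<mu> \<le> 1" "0 \<le> f N / \<mu>" for N
    using f[of N] supercritical by (auto simp: divide_simps)
  have h: "?h \<in> borel_measurable \<Omega>" "\<And>N. 0 \<le> ?h N" "\<And>N. ?h N \<le> 1"
    using f_le by auto
  note prod = integral_prod_subtrees[OF h]
  have int_g: "integrable \<Omega> g"
    unfolding g_def[abs_def] using prod(1) by simp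
  have g_le: "g N \<le> branch_avg \<mu> f N" for N
  proof -
    have "1 - (\<Sum>i<N []. f (subtree_offspring i N) / \<mu>) \<le> (\<Prod>i<N []. ?h (subtree_offspring i N))"
      using f_le by (intro Weierstrass_prod_ineq) auto
    then show ?thesis
      by (simp add: g_def branch_avg_def sum_divide_distrib)
  qed
  have pow_int: "integrable (measure_pmf p) (\<lambda>k. (1 - a / \<mu>) ^ k)"
  proof (intro measure_pmf.integrable_const_bound[where B = 1] AE_I2)
    have "0 \<le> 1 - a / \<mu>" "1 - a / \<mu> \<le> 1"
      using a supercritical by (auto simp: divide_simps)
    then show "norm ((1 - a / \<mu>) ^ k) \<le> 1" for k
      unfolding norm_power using power_le_one[of "norm (1 - a / \<mu>)" k] by simp
  qed simp
  have "(\<integral>N. ?h N \<partial>\<Omega>) = 1 - a / \<mu>"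
    using int_f by (simp add: a_def prob_space)
  then have int_g_eq: "(\<integral>N. g N \<partial>\<Omega>) = 1 - measure_pmf.expectation p (\<lambda>k. (1 - a / \<mu>) ^ k)"
    unfolding g_def[abs_def] using prod by (simp add: prob_space)
  have "(\<integral>N. \<bar>f N - branch_avg \<mu> f N\<bar> \<partial>\<Omega>) \<le> (\<integral>N. (f N - g N) + (branch_avg \<mu> f N - g N) \<partial>\<Omega>)"
  proof (rule integral_mono)
    fix N
    have "g N \<le> f N"
      using ge[of N] by (simp add: g_def)
    then show "\<bar>f N - branch_avg \<mu> f N\<bar> \<le> (f N - g N) + (branch_avg \<mu> f N - g N)"
      using g_le[of N] by linarith
  qed (use int_f int_g integrable_branch_avg[OF int_f] in simp_all)
  also have "\<dots> = 2 * (a - (\<integral>N. g N \<partial>\<Omega>))"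
    using int_f int_g integrable_branch_avg[OF int_f] by (simp add: integral_branch_avg a_def)
  \<comment> \<open>As \<open>\<mu>\<close> is the mean of k, \<open>a\<close> is the mean of
    \<open>k * (a / \<mu>)\<close>; the gap is thus the mean union bound defect for k events of
    probability \<open>a / \<mu>\<close>.\<close>
  also have "a - (\<integral>N. g N \<partial>\<Omega>) =
      measure_pmf.expectation p (\<lambda>k. real k * (a / \<mu>) - 1 + (1 - a / \<mu>) ^ k)"
    using integrable_offspring pow_int supercritical by (simp add: int_g_eq integral_offspring)
  also have "\<dots> \<le> measure_pmf.expectation p (\<lambda>k. (real k / \<mu>) powr \<beta> * a powr \<beta>)"
  proof (rule integral_mono)
    fix k
    show "real k * (a / \<mu>) - 1 + (1 - a / \<mu>) ^ k \<le> (real k / \<mu>) powr \<beta> * a powr \<beta>"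
      using union_bound_defect_le[of "a / \<mu>" \<beta> k] a supercritical beta
      by (simp add: powr_mult[symmetric] divide_simps)
  qed (use integrable_offspring pow_int integrable_normalized_moment in auto)
  also have "\<dots> = normalized_moment * a powr \<beta>"
    by (simp add: normalized_moment_def)
  finally show ?thesis
    by (simp add: a_def)
qed

abbreviation W where "W m \<equiv> (branch_avg \<mu> ^^ m) (\<lambda>_. 1)"

lemma integrable_W: "integrable \<Omega> (W m)"
  by (intro integrable_branch_avg_iter) simp

lemma W_nonneg: "0 \<le> W m N"
  using supercritical
  by (induction m arbitrary: N) (auto simp: branch_avg_def intro!: divide_nonneg_pos sum_nonneg)

text \<open>The depth \<open>m\<close> costs a linear factor in the first error and gains
  \<open>\<mu> ^ m\<close> in the second. Since f takes values in [0, 1], its second moment is at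
  most its mean a, so the second error is sqrt (a / mu^m) before the division by a.\<close>

lemma integral_abs_normalized_diff_le:
  assumes f_meas [measurable]: "f \<in> borel_measurable \<Omega>"
    and f: "\<And>N. 0 \<le> f N" "\<And>N. f N \<le> 1"
    and ge: "\<And>N. 1 - (\<Prod>i<N []. 1 - f (subtree_offspring i N) / \<mu>) \<le> f N"
    and pos: "0 < (\<integral>N. f N \<partial>\<Omega>)"
  shows "(\<integral>N. \<bar>f N / (\<integral>N. f N \<partial>\<Omega>) - W m N\<bar> \<partial>\<Omega>) \<le>
    2 * normalized_moment * (m * (\<integral>N. f N \<partial>\<Omega>) powr (\<beta> - 1)) + sqrt (1 / ((\<integral>N. f N \<partial>\<Omega>) * \<mu> ^ m))"
proof -
  define a where "a = (\<integral>N. f N \<partial>\<Omega>)"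
  have int_f: "integrable \<Omega> f"
    using f by (intro integrable_const_bound[where B = 1]) auto
  have int_f2: "integrable \<Omega> (\<lambda>N. (f N)\<^sup>2)"
    using f by (intro integrable_const_bound[where B = 1]) (auto simp: power_le_one)
  have f2_le: "(\<integral>N. (f N)\<^sup>2 \<partial>\<Omega>) \<le> a"
    unfolding a_def
    using f int_f int_f2 by (intro integral_mono) (auto simp: power2_eq_square mult_left_le)
  note ints = int_f integrable_branch_avg_iter[OF int_f, of m] integrable_W[of m]
  have a: "0 < a"
    using pos by (simp add: a_def)
  have "a * (\<integral>N. \<bar>f N / a - W m N\<bar> \<partial>\<Omega>) = (\<integral>N. \<bar>f N - a * W m N\<bar> \<partial>\<Omega>)"
  proof -
    have "\<bar>f N - a * W m N\<bar> = a * \<bar>f N / a - W m N\<bar>" for N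
    proof -
      have "f N - a * W m N = a * (f N / a - W m N)"
        using a by (simp add: right_diff_distrib)
      then show ?thesis
        using a by (simp add: abs_mult)
    qed
    then show ?thesis by simp
  qed
  also have "\<dots> \<le> (\<integral>N. \<bar>f N - (branch_avg \<mu> ^^ m) f N\<bar> + \<bar>(branch_avg \<mu> ^^ m) f N - a * W m N\<bar> \<partial>\<Omega>)"
    using ints by (intro integral_mono) auto
  also have "\<dots> = (\<integral>N. \<bar>f N - (branch_avg \<mu> ^^ m) f N\<bar> \<partial>\<Omega>) +
      (\<integral>N. \<bar>(branch_avg \<mu> ^^ m) f N - a * W m N\<bar> \<partial>\<Omega>)"
    using ints by (intro Bochner_Integration.integral_add) auto
  also have "(\<integral>N. \<bar>f N - (branch_avg \<mu> ^^ m) f N\<bar> \<partial>\<Omega>) \<le> m * (2 * normalized_moment * a powr \<beta>)"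
    using integral_abs_diff_branch_avg_iter_le[OF int_f, of m]
      mult_left_mono[OF integral_abs_diff_branch_avg_le[OF f_meas f ge], of "real m"]
    by (simp add: a_def)
  also have "(\<integral>N. \<bar>(branch_avg \<mu> ^^ m) f N - a * W m N\<bar> \<partial>\<Omega>) \<le> sqrt (a / \<mu> ^ m)"
  proof -
    have "sqrt ((\<integral>N. (f N)\<^sup>2 \<partial>\<Omega>) / \<mu> ^ m) \<le> sqrt (a / \<mu> ^ m)"
      using f2_le supercritical by (intro real_sqrt_le_mono divide_right_mono) auto
    then show ?thesis
      using integral_abs_branch_avg_iter_centered_le[OF int_f int_f2, of m]
      unfolding a_def by (rule order_trans[rotated])
  qed
  also have "m * (2 * normalized_moment * a powr \<beta>) + sqrt (a / \<mu> ^ m) =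
      a * (2 * normalized_moment * (m * a powr (\<beta> - 1)) + sqrt (1 / (a * \<mu> ^ m)))"
  proof -
    have "a powr \<beta> = a * a powr (\<beta> - 1)"
      using a powr_mult_base[of a "\<beta> - 1"] by simp
    moreover have "sqrt (a / \<mu> ^ m) = a * sqrt (1 / (a * \<mu> ^ m))"
      using a real_sqrt_mult[of "a\<^sup>2" "1 / (a * \<mu> ^ m)"] by (simp add: power2_eq_square)
    ultimately show ?thesis
      by (simp add: algebra_simps)
  qed
  finally show ?thesis
    using a by (simp add: a_def)
qed

text \<open>
  Since \<^term>\<open>\<beta>\<close> may be smaller than 2, the offspring numbers need not have a variance; they are
  truncated at \<open>\<mu> ^ m\<close>.
\<close>

lemma integral_abs_W_increment_le:
  "(\<integral>N. \<bar>W (Suc m) N - W m N\<bar> \<partial>\<Omega>) \<le>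
    (2 * normalized_moment + sqrt normalized_moment) * (\<mu> powr ((1 - \<beta>) / 2)) ^ m"
proof -
  let ?L = "branch_avg \<mu> ^^ m"
  \<comment> \<open>Truncation at B leaves a tail of order B^(1 - \<beta>) and a variance of order
    B^(2 - \<beta>) / \<open>\<mu> ^ m\<close>; with B = \<open>\<mu> ^ m\<close> both are of order
    \<open>\<rho>\<close>^(2m), and the square root of the variance gives the rate
    \<open>\<rho>\<close>^m.\<close>
  define B where "B = \<mu> ^ m"
  define f where "f = branch_avg \<mu> (\<lambda>_. 1)"
  define fB where "fB N = min (f N) B" for N
  define b where "b = (\<integral>N. fB N \<partial>\<Omega>)"
  define \<rho> where "\<rho> = \<mu> powr ((1 - \<beta>) / 2)"
  have B: "0 < B"
    using supercritical by (simp add: B_def)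
  have f_eq: "f N = real (N []) / \<mu>" for N
    by (simp add: f_def branch_avg_def)
  have f_nonneg: "0 \<le> f N" for N
    using supercritical by (simp add: f_eq)
  have int_f: "integrable \<Omega> f" and f_1: "(\<integral>N. f N \<partial>\<Omega>) = 1"
    unfolding f_def by (auto simp: integrable_branch_avg integral_branch_avg prob_space)
  have [measurable]: "f \<in> borel_measurable \<Omega>"
    using int_f by simp
  have int_fB: "integrable \<Omega> fB"
    unfolding fB_def[abs_def] using int_f by simp
  have int_fB2: "integrable \<Omega> (\<lambda>N. (fB N)\<^sup>2)"
    unfolding fB_def[abs_def] using f_nonneg B
    by (intro integrable_const_bound[where B = "B\<^sup>2"]) (auto intro!: power_mono)
  \<comment> \<open>With no subtrees involved, the branching lemma just says that the root degree
    has law \<open>p\<close>.\<close>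
  have moment: "integrable \<Omega> (\<lambda>N. f N powr \<beta>)" "(\<integral>N. f N powr \<beta> \<partial>\<Omega>) = normalized_moment"
    using integrable_branching[OF integrable_normalized_moment finite.emptyI, of "\<lambda>_ _. 0"]
      integral_branching[OF integrable_normalized_moment finite.emptyI, of "\<lambda>_ _. 0"]
    by (auto simp: f_eq normalized_moment_def)
  have tail: "1 - b \<le> normalized_moment * B powr (1 - \<beta>)" and b_le: "b \<le> 1"
  proof -
    \<comment> \<open>Above the level B, f = f^\<beta> f^(1 - \<beta>), and the last exponent is
      negative.\<close>
    have "f N - fB N \<le> f N powr \<beta> * B powr (1 - \<beta>)" for N
    proof (cases "f N \<le> B")
      case False
      then have "B powr (\<beta> - 1) \<le> f N powr (\<beta> - 1)"
        using B beta by (intro powr_mono2) auto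
      then have "f N \<le> f N powr \<beta> * B powr (1 - \<beta>)"
        using False B by (simp add: powr_diff divide_simps mult.commute)
      then show ?thesis
        using False B by (simp add: fB_def)
    qed (simp add: fB_def)
    then have "(\<integral>N. f N - fB N \<partial>\<Omega>) \<le> (\<integral>N. f N powr \<beta> * B powr (1 - \<beta>) \<partial>\<Omega>)"
      using int_f int_fB moment by (intro integral_mono) auto
    then show "1 - b \<le> normalized_moment * B powr (1 - \<beta>)"
      using int_f int_fB moment by (simp add: f_1 b_def)
    have "b \<le> (\<integral>N. f N \<partial>\<Omega>)"
      unfolding b_def using int_f int_fB by (intro integral_mono) (auto simp: fB_def)
    then show "b \<le> 1"
      by (simp add: f_1)
  qed
  have square: "(\<integral>N. (fB N)\<^sup>2 \<partial>\<Omega>) \<le> normalized_moment * B powr (2 - \<beta>)"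
  proof -
    \<comment> \<open>Since \<beta> is at most 2, the leftover factor fB^(2 - \<beta>) is bounded by
      B^(2 - \<beta>).\<close>
    have "(fB N)\<^sup>2 \<le> f N powr \<beta> * B powr (2 - \<beta>)" for N
    proof (cases "f N = 0")
      case False
      then have "0 < f N"
        using f_nonneg[of N] by simp
      then have pos: "0 < fB N"
        using B by (simp add: fB_def)
      then have "(fB N)\<^sup>2 = fB N powr \<beta> * fB N powr (2 - \<beta>)"
        by (simp add: powr_add[symmetric])
      also have "\<dots> \<le> f N powr \<beta> * B powr (2 - \<beta>)"
        using pos beta by (intro mult_mono powr_mono2) (auto simp: fB_def)
      finally show ?thesis .
    qed (use B in \<open>simp add: fB_def\<close>)
    then have "(\<integral>N. (fB N)\<^sup>2 \<partial>\<Omega>) \<le> (\<integral>N. f N powr \<beta> * B powr (2 - \<beta>) \<partial>\<Omega>)"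
      using int_fB2 moment by (intro integral_mono) auto
    then show ?thesis
      using moment by simp
  qed
  note ints = integrable_branch_avg_iter[OF int_f, of m] integrable_branch_avg_iter[OF int_fB, of m]
    integrable_W[of m]
  have rho_B: "B powr (1 - \<beta>) = (\<rho> ^ m)\<^sup>2" "B powr (2 - \<beta>) / \<mu> ^ m = (\<rho> ^ m)\<^sup>2"
  proof -
    have "\<rho> ^ m = B powr ((1 - \<beta>) / 2)"
      using supercritical by (simp add: B_def \<rho>_def powr_power powr_realpow[symmetric] powr_powr mult.commute)
    then show *: "B powr (1 - \<beta>) = (\<rho> ^ m)\<^sup>2"
      by (simp add: power2_eq_square powr_add[symmetric])
    have "B powr (2 - \<beta>) = B powr (1 - \<beta>) * \<mu> ^ m"
      using B powr_add[of B "1 - \<beta>" 1] by (simp add: B_def)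
    with * show "B powr (2 - \<beta>) / \<mu> ^ m = (\<rho> ^ m)\<^sup>2"
      using supercritical by simp
  qed
  have \<rho>: "0 \<le> \<rho>" "\<rho> \<le> 1"
    using powr_less_one[of \<mu> "(1 - \<beta>) / 2"] supercritical beta by (simp_all add: \<rho>_def)
  \<comment> \<open>\<open>W (Suc m)\<close> is read as m averagings of the normalized root degree
    f: each vertex of generation m reproduces once more.\<close>
  have "(\<integral>N. \<bar>W (Suc m) N - W m N\<bar> \<partial>\<Omega>) = (\<integral>N. \<bar>?L f N - W m N\<bar> \<partial>\<Omega>)"
    by (simp add: f_def funpow_Suc_right del: funpow.simps)
  \<comment> \<open>Three contributions: the part cut off, the centred fluctuation of the truncated
    part, and the loss of mean \<open>1 - b\<close> caused by the truncation.\<close>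
  also have "\<dots> \<le> (\<integral>N. \<bar>?L (\<lambda>N. f N - fB N) N\<bar> + \<bar>?L fB N - b * W m N\<bar> + (1 - b) * W m N \<partial>\<Omega>)"
  proof (intro integral_mono)
    fix N
    have "\<bar>(b - 1) * W m N\<bar> = (1 - b) * W m N"
      using b_le W_nonneg[of m N] by (simp add: abs_mult)
    then show "\<bar>?L f N - W m N\<bar> \<le> \<bar>?L (\<lambda>N. f N - fB N) N\<bar> + \<bar>?L fB N - b * W m N\<bar> + (1 - b) * W m N"
      unfolding branch_avg_iter_diff by (simp add: algebra_simps)
  qed (use ints in \<open>auto simp: branch_avg_iter_diff\<close>)
  also have "\<dots> = (\<integral>N. \<bar>?L (\<lambda>N. f N - fB N) N\<bar> \<partial>\<Omega>) + (\<integral>N. \<bar>?L fB N - b * W m N\<bar> \<partial>\<Omega>) + (1 - b)"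
    using ints integral_branch_avg_iter[of "\<lambda>_. 1" m] by (simp add: branch_avg_iter_diff prob_space)
  also have "(\<integral>N. \<bar>?L (\<lambda>N. f N - fB N) N\<bar> \<partial>\<Omega>) \<le> (\<integral>N. \<bar>f N - fB N\<bar> \<partial>\<Omega>)"
    using int_f int_fB by (intro integral_abs_branch_avg_iter_le) auto
  also have "\<dots> = (\<integral>N. f N - fB N \<partial>\<Omega>)"
    by (intro Bochner_Integration.integral_cong) (auto simp: fB_def)
  also have "\<dots> = 1 - b"
    using int_f int_fB by (simp add: f_1 b_def)
  also have "(\<integral>N. \<bar>?L fB N - b * W m N\<bar> \<partial>\<Omega>) \<le> sqrt ((\<integral>N. (fB N)\<^sup>2 \<partial>\<Omega>) / \<mu> ^ m)"
    unfolding b_def by (rule integral_abs_branch_avg_iter_centered_le[OF int_fB int_fB2])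
  also have "\<dots> \<le> sqrt (normalized_moment * B powr (2 - \<beta>) / \<mu> ^ m)"
    using square supercritical by (intro real_sqrt_le_mono divide_right_mono) auto
  also have "\<dots> = sqrt normalized_moment * \<rho> ^ m"
    using rho_B(2) \<rho> by (simp add: real_sqrt_mult times_divide_eq_right[symmetric] del: times_divide_eq_right)
  also have "1 - b + sqrt normalized_moment * \<rho> ^ m + (1 - b) \<le>
      (2 * normalized_moment + sqrt normalized_moment) * \<rho> ^ m"
  proof -
    have "1 - b \<le> normalized_moment * \<rho> ^ m"
    proof -
      have "(\<rho> ^ m)\<^sup>2 \<le> \<rho> ^ m"
        using \<rho> by (simp add: power2_eq_square mult_left_le power_le_one)
      then show ?thesis
        using tail mult_left_mono[OF _ normalized_moment_nonneg] by (force simp: rho_B)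
    qed
    then show ?thesis
      by (simp add: algebra_simps)
  qed
  finally show ?thesis
    by (simp add: \<rho>_def)
qed

text \<open>\<open>GW_limit\<close> is a \<open>lim\<close>, which carries no information before
  convergence is known. The increments decay geometrically in L^1 because
  \<open>\<beta> > 1\<close>.\<close>

lemma AE_convergent_W: "AE N in \<Omega>. convergent (\<lambda>m. W m N)"
proof -
  have "\<mu> powr ((1 - \<beta>) / 2) < 1"
    using supercritical beta by (simp add: powr_less_one)
  then have "summable (\<lambda>m. (2 * normalized_moment + sqrt normalized_moment) * (\<mu> powr ((1 - \<beta>) / 2)) ^ m)"
    by (intro summable_mult summable_geometric) simp
  then have "summable (\<lambda>m. \<integral>N. \<bar>W (Suc m) N - W m N\<bar> \<partial>\<Omega>)"
    by (rule summable_comparison_test'[where N = 0]) (use integral_abs_W_increment_le in simp)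
  then have "AE N in \<Omega>. summable (\<lambda>m. \<bar>W (Suc m) N - W m N\<bar>)"
    by (intro AE_summable_of_summable_integral_abs Bochner_Integration.integrable_diff integrable_W)
  then show ?thesis
    by eventually_elim (rule convergent_of_summable_abs_diff)
qed

end

section \<open>Measurability and moments of the offspring law\<close>

text \<open>The generating events concern single vertices, so a generation is compared with each of
  countably many lists. The value 0 stands for an empty and for an infinite generation alike and is
  reached by complement.\<close>

lemma measurable_card_generation [measurable]:
  "(\<lambda>T. card (generation T m)) \<in> measurable tree_space (count_space UNIV)"
proof (subst measurable_count_space_eq2_countable, intro conjI ballI)
  have mem [measurable]: "Measurable.pred tree_space (\<lambda>T. v \<in> T)" for v :: vertex
    by (auto simp: pred_def tree_space_def intro!: sigma_sets.Basic)
  have pos: "(\<lambda>T. card (generation T m)) -` {Suc j} \<inter> space tree_space \<in> sets tree_space" for j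
  proof -
    have "card (generation T m) = Suc j \<longleftrightarrow>
        (\<exists>xs. (distinct xs \<and> length xs = Suc j) \<and> (\<forall>v. (v \<in> T \<and> length v = m) \<longleftrightarrow> v \<in> set xs))" for T
    proof
      assume card: "card (generation T m) = Suc j"
      then have "finite (generation T m)"
        by (intro card_ge_0_finite) simp
      then obtain xs where "set xs = generation T m" "distinct xs"
        using finite_distinct_list by blast
      with card show "\<exists>xs. (distinct xs \<and> length xs = Suc j) \<and>
          (\<forall>v. (v \<in> T \<and> length v = m) \<longleftrightarrow> v \<in> set xs)"
        by (intro exI[of _ xs]) (auto simp: generation_def distinct_card[symmetric])
    next
      assume "\<exists>xs. (distinct xs \<and> length xs = Suc j) \<and> (\<forall>v. (v \<in> T \<and> length v = m) \<longleftrightarrow> v \<in> set xs)"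
      then obtain xs where "distinct xs" "length xs = Suc j" "generation T m = set xs"
        by (auto simp: generation_def)
      then show "card (generation T m) = Suc j"
        by (simp add: distinct_card)
    qed
    then have "(\<lambda>T. card (generation T m)) -` {Suc j} \<inter> space tree_space =
        {T \<in> space tree_space. \<exists>xs. (distinct xs \<and> length xs = Suc j) \<and>
          (\<forall>v. (v \<in> T \<and> length v = m) \<longleftrightarrow> v \<in> set xs)}"
      by auto
    also have "\<dots> \<in> sets tree_space"
      by measurable
    finally show ?thesis .
  qed
  show "(\<lambda>T. card (generation T m)) -` {a} \<inter> space tree_space \<in> sets tree_space" for a
  proof (cases a)
    case 0
    have "(\<lambda>T. card (generation T m)) -` {a} \<inter> space tree_space =
        space tree_space - (\<Union>j. (\<lambda>T. card (generation T m)) -` {Suc j} \<inter> space tree_space)"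
      unfolding 0 by (auto, metis not0_implies_Suc)
    also have "\<dots> \<in> sets tree_space"
      using pos by (intro sets.compl_sets sets.countable_UN) auto
    finally show ?thesis .
  qed (use pos in simp)
qed auto

lemma borel_measurable_GW_limit [measurable]: "GW_limit \<mu> \<in> borel_measurable tree_space"
  unfolding GW_limit_def[abs_def] by (intro borel_measurable_lim_metric) measurable

text \<open>Tolerances 1 / (j + 1) reduce convergence to countable quantifiers. The measurable event
  is wanted for the transfer of the almost sure statement along \<open>distr\<close>.\<close>

lemma sets_tendsto:
  fixes f :: "nat \<Rightarrow> 'a \<Rightarrow> real"
  assumes [measurable]: "\<And>n. f n \<in> borel_measurable M" "g \<in> borel_measurable M"
  shows "{x \<in> space M. (\<lambda>n. f n x) \<longlonglongrightarrow> g x} \<in> sets M"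
proof -
  have "(\<lambda>n. f n x) \<longlonglongrightarrow> g x \<longleftrightarrow> (\<forall>j. \<exists>m. \<forall>n\<in>{m..}. \<bar>f n x - g x\<bar> < inverse (real (Suc j)))" for x
  proof
    assume "(\<lambda>n. f n x) \<longlonglongrightarrow> g x"
    then show "\<forall>j. \<exists>m. \<forall>n\<in>{m..}. \<bar>f n x - g x\<bar> < inverse (real (Suc j))"
      unfolding LIMSEQ_iff real_norm_def Ball_def atLeast_iff
      by (intro allI) (metis inverse_positive_iff_positive of_nat_0_less_iff zero_less_Suc)
  next
    assume *: "\<forall>j. \<exists>m. \<forall>n\<in>{m..}. \<bar>f n x - g x\<bar> < inverse (real (Suc j))"
    show "(\<lambda>n. f n x) \<longlonglongrightarrow> g x"
      unfolding LIMSEQ_iff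
    proof (intro allI impI)
      fix r :: real assume "0 < r"
      then obtain j where j: "inverse (real (Suc j)) < r"
        using reals_Archimedean by blast
      obtain m where "\<forall>n\<in>{m..}. \<bar>f n x - g x\<bar> < inverse (real (Suc j))"
        using * by blast
      then show "\<exists>no. \<forall>n\<ge>no. norm (f n x - g x) < r"
        using j by (intro exI[of _ m]) force
    qed
  qed
  then have "{x \<in> space M. (\<lambda>n. f n x) \<longlonglongrightarrow> g x} =
      {x \<in> space M. \<forall>j. \<exists>m. \<forall>n\<in>{m..}. \<bar>f n x - g x\<bar> < inverse (real (Suc j))}"
    by simp
  also have "\<dots> \<in> sets M"
    by measurable
  finally show ?thesis .
qed

lemma GW_law_eq_distr: "GW_law p = distr (offspring_space p) tree_space tree_of_offspring"
  by (simp add: GW_law_def offspring_space_def)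

lemma measurable_tree_of_offspring' [measurable]:
  "tree_of_offspring \<in> measurable (offspring_space p) tree_space"
  unfolding offspring_space_def by (rule measurable_tree_of_offspring)

lemma GW_law_degree_tail:
  "measure (GW_law p) {T. x \<le> real (card (generation T 1))} = measure_pmf.prob p {k. x \<le> real k}"
proof -
  \<comment> \<open>With \<open>\<mu>\<close> set to 1 the normalization of generation sizes
    disappears.\<close>
  have card_1: "card (generation (tree_of_offspring N) 1) = N []" for N
    using card_generation_tree[of 1 N 1] by (simp add: branch_avg_def)
  have "{T \<in> space tree_space. x \<le> real (card (generation T 1))} \<in> sets tree_space"
    by measurable
  then have "measure (GW_law p) {T. x \<le> real (card (generation T 1))} =
      measure (offspring_space p) ((\<lambda>N. N []) -` {k. x \<le> real k} \<inter> space (offspring_space p))"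
    unfolding GW_law_eq_distr by (subst measure_distr) (auto simp: vimage_def card_1[unfolded One_nat_def])
  also have "\<dots> = measure (distr (offspring_space p) (measure_pmf p) (\<lambda>N. N [])) {k. x \<le> real k}"
    by (subst measure_distr) (auto simp: measurable_offspring_eval[simplified])
  also have "distr (offspring_space p) (measure_pmf p) (\<lambda>N. N []) = measure_pmf p"
    unfolding offspring_space_def
    by (intro distr_PiM_component measure_pmf.prob_space_axioms) auto
  finally show ?thesis .
qed

text \<open>On the dyadic block 2^j <= k < 2^(j + 1) the power is at most (2^(j + 1))^\<beta>, and
  the block is contained in the tail k >= 2^j.\<close>

lemma integrable_powr_of_dyadic_tail:
  fixes p :: "nat pmf" and \<beta> :: real
  assumes "0 \<le> \<beta>"
    and sum: "summable (\<lambda>j. (2 ^ Suc j) powr \<beta> * measure_pmf.prob p {k. 2 ^ j \<le> k})"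
  shows "integrable (measure_pmf p) (\<lambda>k. real k powr \<beta>)"
proof (rule integrableI_nonneg)
  let ?t = "\<lambda>j k. (2 ^ Suc j) powr \<beta> * indicator {k. 2 ^ j \<le> k} (k::nat) :: real"
  have le: "ennreal (real k powr \<beta>) \<le> (\<Sum>j. ennreal (?t j k))" for k
  proof (cases "k = 0")
    case False
    then obtain j where j: "2 ^ j \<le> k" "k < 2 ^ Suc j"
      using ex_power_ivl1[of 2 k] False by (metis Suc_eq_plus1 One_nat_def Suc_leI le_refl not_gr_zero)
    then have "real k \<le> 2 ^ Suc j"
    proof -
      have "real k < real (2 ^ Suc j)"
        using j(2) by (simp only: of_nat_less_iff)
      then show ?thesis
        by simp
    qed
    then have "real k powr \<beta> \<le> ?t j k"
      using j(1) powr_mono2[OF assms(1), of "real k" "2 ^ Suc j"] by (simp del: power_Suc)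
    then have "ennreal (real k powr \<beta>) \<le> ennreal (?t j k)"
      by (rule ennreal_leI)
    also have "\<dots> \<le> (\<Sum>j. ennreal (?t j k))"
    proof -
      have "g j \<le> suminf g" for g :: "nat \<Rightarrow> ennreal"
        using sum_le_suminf[OF summableI, of "{j}" g] by simp
      then show ?thesis .
    qed
    finally show ?thesis .
  qed simp
  have "(\<integral>\<^sup>+k. ennreal (real k powr \<beta>) \<partial>measure_pmf p) \<le> (\<integral>\<^sup>+k. (\<Sum>j. ennreal (?t j k)) \<partial>measure_pmf p)"
    by (intro nn_integral_mono le)
  also have "\<dots> = (\<Sum>j. \<integral>\<^sup>+k. ennreal (?t j k) \<partial>measure_pmf p)"
    by (intro nn_integral_suminf) simp
  also have "\<dots> = (\<Sum>j. ennreal ((2 ^ Suc j) powr \<beta> * measure_pmf.prob p {k. 2 ^ j \<le> k}))"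
  proof (intro suminf_cong)
    fix j
    have "(\<integral>\<^sup>+k. ennreal (?t j k) \<partial>measure_pmf p) =
        (\<integral>\<^sup>+k. ennreal ((2 ^ Suc j) powr \<beta>) * indicator {k. 2 ^ j \<le> k} k \<partial>measure_pmf p)"
      by (intro nn_integral_cong) (auto simp: indicator_def)
    also have "\<dots> = ennreal ((2 ^ Suc j) powr \<beta>) * ennreal (measure_pmf.prob p {k. 2 ^ j \<le> k})"
      by (simp add: nn_integral_cmult measure_pmf.emeasure_eq_measure del: power_Suc)
    finally show "(\<integral>\<^sup>+k. ennreal (?t j k) \<partial>measure_pmf p) =
        ennreal ((2 ^ Suc j) powr \<beta> * measure_pmf.prob p {k. 2 ^ j \<le> k})"
      by (simp add: ennreal_mult del: power_Suc)
  qed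
  also have "\<dots> < \<infinity>"
  proof -
    have nonneg: "0 \<le> (2 ^ Suc j) powr \<beta> * measure_pmf.prob p {k. 2 ^ j \<le> k}" for j
      by (intro mult_nonneg_nonneg) auto
    show ?thesis
      unfolding suminf_ennreal2[OF nonneg sum] infinity_ennreal_def by (rule ennreal_less_top)
  qed
  finally show "(\<integral>\<^sup>+k. ennreal (real k powr \<beta>) \<partial>measure_pmf p) < \<infinity>" .
qed auto

lemma offspring_in_class_moment:
  assumes "offspring_in_class \<alpha> p" and int: "integrable (measure_pmf p) real"
  shows "\<exists>\<beta>. 1 < \<beta> \<and> \<beta> \<le> 2 \<and> integrable (measure_pmf p) (\<lambda>k. real k powr \<beta>)"
  using assms(1) unfolding offspring_in_class_def
proof (elim disjE conjE exE)
  assume sq: "integrable (measure_pmf p) (\<lambda>k. (real k - offspring_mean p)\<^sup>2)"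
  define m where "m = offspring_mean p"
  have "real k powr 2 = (real k - m)\<^sup>2 + (2 * m * real k - m\<^sup>2)" for k :: nat
    by (simp add: power2_eq_square algebra_simps)
  moreover have "integrable (measure_pmf p) (\<lambda>k. (real k - m)\<^sup>2 + (2 * m * real k - m\<^sup>2))"
    using sq int by (simp add: m_def)
  ultimately have "integrable (measure_pmf p) (\<lambda>k. real k powr 2)"
    by simp
  then show ?thesis
    by (intro exI[of _ 2]) auto
next
  fix c :: real
  assume \<alpha>: "1 < \<alpha>" "\<alpha> < 2" and c: "0 < c"
    and "(\<lambda>x::real. measure (GW_law p) {T. x \<le> real (card (generation T 1))})
      \<sim>[at_top] (\<lambda>x. c * x powr (- \<alpha>))"
  then have "(\<lambda>x::real. measure_pmf.prob p {k. x \<le> real k}) \<sim>[at_top] (\<lambda>x. c * x powr (- \<alpha>))"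
    by (simp only: GW_law_degree_tail)
  then have "((\<lambda>x::real. measure_pmf.prob p {k. x \<le> real k} / (c * x powr (- \<alpha>))) \<longlongrightarrow> 1) at_top"
    using c by (rule_tac asymp_equivD_strong) (auto intro!: eventually_mono[OF eventually_gt_at_top[of 0]])
  then have "\<forall>\<^sub>F x in at_top. measure_pmf.prob p {k. x \<le> real k} / (c * x powr (- \<alpha>)) < 2"
    by (rule order_tendstoD) simp
  then have "\<forall>\<^sub>F x::real in at_top. measure_pmf.prob p {k. x \<le> real k} \<le> 2 * c * x powr (- \<alpha>)"
    using eventually_gt_at_top[of 0]
  proof eventually_elim
    case (elim x)
    then have "0 < c * x powr (- \<alpha>)"
      using c by simp
    with elim show ?case
      by (simp add: pos_divide_less_eq mult.assoc less_imp_le)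
  qed
  moreover have "filterlim (\<lambda>j. 2 ^ j :: real) at_top sequentially"
    by (rule filterlim_at_top_mono[OF filterlim_real_sequentially])
      (intro always_eventually allI less_imp_le of_nat_less_two_power)
  ultimately have tail: "\<forall>\<^sub>F j in sequentially.
      measure_pmf.prob p {k. 2 ^ j \<le> real k} \<le> 2 * c * (2 ^ j) powr (- \<alpha>)"
    by (rule eventually_compose_filterlim)
  have pow: "((2::real) ^ j) powr s = (2 powr s) ^ j" for j s
    by (simp add: powr_realpow[symmetric] powr_powr powr_power mult.commute)
  \<comment> \<open>The dyadic series is dominated by a geometric one of ratio 2^(\<beta> -
    \<alpha>), so \<beta> is taken strictly between 1 and \<alpha>; at \<beta> = \<alpha> the ratio
    would be 1.\<close>
  define \<beta> where "\<beta> = (1 + \<alpha>) / 2"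
  have \<beta>: "1 < \<beta>" "\<beta> \<le> 2" "\<beta> < \<alpha>"
    using \<alpha> by (auto simp: \<beta>_def)
  have "(2::real) powr (\<beta> - \<alpha>) < 1"
    using \<beta> by (simp add: powr_less_one)
  then have geometric: "summable (\<lambda>j. 2 powr \<beta> * (2 * c) * (2 powr (\<beta> - \<alpha>)) ^ j)"
    by (intro summable_mult summable_geometric) simp
  have "summable (\<lambda>j. (2 ^ Suc j) powr \<beta> * measure_pmf.prob p {k. 2 ^ j \<le> k})"
  proof (rule summable_comparison_test_ev[OF _ geometric])
    show "\<forall>\<^sub>F j in sequentially. norm ((2 ^ Suc j) powr \<beta> * measure_pmf.prob p {k. 2 ^ j \<le> k})
        \<le> 2 powr \<beta> * (2 * c) * (2 powr (\<beta> - \<alpha>)) ^ j"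
      using tail
    proof eventually_elim
      case (elim j)
      have "{k. (2::real) ^ j \<le> real k} = {k. 2 ^ j \<le> k}"
        by (metis of_nat_le_iff of_nat_numeral of_nat_power)
      then have "(2 ^ Suc j) powr \<beta> * measure_pmf.prob p {k. 2 ^ j \<le> k} \<le>
          (2 ^ Suc j) powr \<beta> * (2 * c * (2 ^ j) powr (- \<alpha>))"
        using elim by (intro mult_left_mono) auto
      also have "\<dots> = 2 powr \<beta> * (2 * c) * (2 powr (\<beta> - \<alpha>)) ^ j"
        unfolding pow by (simp add: powr_diff powr_minus power_divide field_simps)
      finally show ?case
        by simp
    qed
  qed
  then have "integrable (measure_pmf p) (\<lambda>k. real k powr \<beta>)"
    using \<beta> by (intro integrable_powr_of_dyadic_tail) auto
  with \<beta> show ?thesis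
    by blast
qed

section \<open>Passage to all indices\<close>

lemma tendsto_of_polynomial_subsequence:
  fixes x :: "nat \<Rightarrow> real"
  assumes D: "0 < D" and \<gamma>: "0 \<le> \<gamma>" and antimono: "\<And>m n. m \<le> n \<Longrightarrow> x n \<le> x m"
    and nonneg: "\<And>n. 0 \<le> x n"
    and lim: "(\<lambda>k. real (k ^ D) powr \<gamma> * x (k ^ D)) \<longlonglongrightarrow> l"
  shows "(\<lambda>n. real n powr \<gamma> * x n) \<longlonglongrightarrow> l"
proof -
  let ?y = "\<lambda>k. real (k ^ D) powr \<gamma> * x (k ^ D)"
  have "\<exists>r. r ^ D \<le> n \<and> n < Suc r ^ D" for n
  proof -
    have "n < Suc n ^ D"
      using self_le_power[of "Suc n" D] D by simp
    moreover have "\<not> n < 0 ^ D"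
      by (simp add: zero_power[OF D])
    ultimately show ?thesis
      using ex_least_nat_less[of "\<lambda>s. n < s ^ D" "Suc n"] by (metis leI order_refl)
  qed
  \<comment> \<open>\<open>r n\<close> is the integer part of the D-th root of n.\<close>
  then obtain r where r: "\<And>n. r n ^ D \<le> n" "\<And>n. n < Suc (r n) ^ D"
    by metis
  have r_at_top: "filterlim r at_top sequentially"
    unfolding filterlim_at_top
  proof
    fix Z
    have "Z \<le> r n" if "Z ^ D \<le> n" for n
      using that r(2)[of n] by (metis le_less_trans less_Suc_eq_le power_less_imp_less_base zero_le)
    then show "\<forall>\<^sub>F n in sequentially. Z \<le> r n"
      by (auto simp: eventually_sequentially)
  qed
  let ?q = "\<lambda>k. real (Suc k ^ D) powr \<gamma> / real (k ^ D) powr \<gamma>"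
  have q: "?q \<longlonglongrightarrow> 1"
  proof -
    have "(\<lambda>k. ((real (Suc k) / real k) ^ D) powr \<gamma>) \<longlonglongrightarrow> (1 ^ D) powr \<gamma>"
      by (intro tendsto_intros LIMSEQ_Suc_n_over_n) auto
    moreover have "((real (Suc k) / real k) ^ D) powr \<gamma> = ?q k" for k
      by (simp add: powr_divide power_divide)
    ultimately show ?thesis
      by simp
  qed
  have "(\<lambda>k. ?q k * ?y k) \<longlonglongrightarrow> 1 * l"
    by (intro tendsto_mult q lim)
  then have upper: "(\<lambda>n. ?q (r n) * ?y (r n)) \<longlonglongrightarrow> l"
    using filterlim_compose[OF _ r_at_top] by fastforce
  \<comment> \<open>The quotient pairs the weight at k^D with the value at (k + 1)^D, lower bounds
    for weight and value on the block between them.\<close>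
  have "(\<lambda>k. ?y (Suc k) / ?q k) \<longlonglongrightarrow> l / 1"
    by (intro tendsto_divide q LIMSEQ_Suc[OF lim]) simp
  then have lower: "(\<lambda>n. ?y (Suc (r n)) / ?q (r n)) \<longlonglongrightarrow> l"
    using filterlim_compose[OF _ r_at_top] by fastforce
  \<comment> \<open>At \<open>r n = 0\<close> the ratio \<open>?q\<close> would divide by 0.\<close>
  have r_pos: "\<forall>\<^sub>F n in sequentially. 1 \<le> r n"
    using r_at_top by (simp add: filterlim_at_top)
  show ?thesis
  proof (rule tendsto_sandwich[OF _ _ lower upper])
    show "\<forall>\<^sub>F n in sequentially. ?y (Suc (r n)) / ?q (r n) \<le> real n powr \<gamma> * x n"
      using r_pos
    proof eventually_elim
      case (elim n)
      then have "?y (Suc (r n)) / ?q (r n) = real (r n ^ D) powr \<gamma> * x (Suc (r n) ^ D)"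
        by simp
      also have "\<dots> \<le> real n powr \<gamma> * x n"
        using r[of n] \<gamma> nonneg by (intro mult_mono powr_mono2 antimono) (auto simp del: of_nat_power)
      finally show ?case .
    qed
    show "\<forall>\<^sub>F n in sequentially. real n powr \<gamma> * x n \<le> ?q (r n) * ?y (r n)"
      using r_pos
    proof eventually_elim
      case (elim n)
      have "real n powr \<gamma> * x n \<le> real (Suc (r n) ^ D) powr \<gamma> * x (r n ^ D)"
        using r[of n] \<gamma> nonneg
        by (intro mult_mono powr_mono2 antimono) (auto simp del: of_nat_power power_Suc of_nat_Suc)
      also have "\<dots> = ?q (r n) * ?y (r n)"
        using elim by simp
      finally show ?case .
    qed
  qed
qed

lemma filterlim_power_nat_at_top:
  assumes "0 < D"
  shows "filterlim (\<lambda>k::nat. k ^ D) at_top sequentially"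
proof (rule filterlim_at_top_mono[OF filterlim_ident])
  have "k \<le> k ^ D" for k :: nat
    using assms self_le_power[of k D] by (cases "k = 0") auto
  then show "\<forall>\<^sub>F k in sequentially. k \<le> k ^ D"
    by simp
qed

lemma polynomial_subsequence_summable:
  fixes a :: "nat \<Rightarrow> real" and \<mu> \<gamma> \<delta> K :: real
  assumes \<gamma>: "0 < \<gamma>" and \<delta>: "0 < \<delta>" and \<mu>: "1 < \<mu>" and K: "0 < K"
    and nonneg: "\<And>n. 0 \<le> a n" and lim: "(\<lambda>n. real n powr \<gamma> * a n) \<longlonglongrightarrow> K"
  shows "\<exists>D>0. summable (\<lambda>k. k * a (k ^ D) powr \<delta>) \<and> summable (\<lambda>k. sqrt (1 / (a (k ^ D) * \<mu> ^ k)))"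
proof -
  \<comment> \<open>a (k^D) is of order k^(-s) with s = D \<gamma>. One power of k pays for the
    factor k and two for summability, whence the 3 in s \<delta> >= 3.\<close>
  define D where "D = Suc (nat \<lceil>3 / (\<gamma> * \<delta>)\<rceil>)"
  define s where "s = D * \<gamma>"
  have D: "0 < D"
    by (simp add: D_def)
  have "3 / (\<gamma> * \<delta>) \<le> D"
    unfolding D_def by linarith
  then have s: "3 \<le> s * \<delta>"
    using \<gamma> \<delta> by (simp add: s_def divide_simps mult.assoc)
  have "\<forall>\<^sub>F n in sequentially. K / 2 < real n powr \<gamma> * a n \<and> real n powr \<gamma> * a n < 2 * K"
    using K by (intro eventually_conj order_tendstoD[OF lim]) auto
  moreover have "filterlim (\<lambda>k. k ^ D) at_top sequentially"
    by (rule filterlim_power_nat_at_top[OF D])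
  ultimately have "\<forall>\<^sub>F k in sequentially. K / 2 < real (k ^ D) powr \<gamma> * a (k ^ D) \<and>
      real (k ^ D) powr \<gamma> * a (k ^ D) < 2 * K"
    by (rule eventually_compose_filterlim)
  then have bounds: "\<forall>\<^sub>F k in sequentially. K / 2 * real k powr (- s) < a (k ^ D) \<and>
      a (k ^ D) < 2 * K * real k powr (- s)"
    using eventually_gt_at_top[of 0]
  proof eventually_elim
    case (elim k)
    have "real (k ^ D) powr \<gamma> = real k powr s"
      using elim by (simp add: s_def powr_realpow[symmetric] powr_powr)
    with elim show ?case
      by (simp add: powr_minus field_simps)
  qed
  have squares: "summable (\<lambda>k. real k powr (- 2))"
    by (simp add: summable_real_powr_iff)
  have "summable (\<lambda>k. k * a (k ^ D) powr \<delta>)"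
  proof (rule summable_comparison_test_ev)
    show "summable (\<lambda>k. (2 * K) powr \<delta> * real k powr (- 2))"
      using squares by (rule summable_mult)
    show "\<forall>\<^sub>F k in sequentially. norm (k * a (k ^ D) powr \<delta>) \<le> (2 * K) powr \<delta> * real k powr (- 2)"
      using bounds eventually_gt_at_top[of 0]
    proof eventually_elim
      case (elim k)
      have "a (k ^ D) powr \<delta> \<le> (2 * K * real k powr (- s)) powr \<delta>"
        using elim nonneg \<delta> by (intro powr_mono2) auto
      also have "\<dots> = (2 * K) powr \<delta> * real k powr (- (s * \<delta>))"
        using K by (simp add: powr_mult powr_powr)
      also have "\<dots> \<le> (2 * K) powr \<delta> * real k powr (- 3)"
        using s elim by (intro mult_left_mono powr_mono) auto
      finally have "k * a (k ^ D) powr \<delta> \<le> k * ((2 * K) powr \<delta> * real k powr (- 3))"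
        by (intro mult_left_mono) auto
      also have "\<dots> = (2 * K) powr \<delta> * real k powr (- 2)"
        using elim powr_mult_base[of "real k" "- 3"] by simp
      finally show ?case
        by simp
    qed
  qed
  moreover have "summable (\<lambda>k. sqrt (1 / (a (k ^ D) * \<mu> ^ k)))"
  proof (rule summable_comparison_test_ev[OF _ squares])
    \<comment> \<open>The exponent s offsets the decay of a (k^D); the extra 4 becomes k^(-2) under
      the square root.\<close>
    have "(\<lambda>k. real k powr (s + 4) / \<mu> ^ k) \<longlonglongrightarrow> 0"
      using \<mu> by real_asymp
    then have "\<forall>\<^sub>F k in sequentially. real k powr (s + 4) / \<mu> ^ k < K / 2"
      using K by (intro order_tendstoD) auto
    then show "\<forall>\<^sub>F k in sequentially. norm (sqrt (1 / (a (k ^ D) * \<mu> ^ k))) \<le> real k powr (- 2)"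
      using bounds eventually_gt_at_top[of 0]
    proof eventually_elim
      case (elim k)
      have pos: "0 < \<mu> ^ k" "0 < K / 2 * real k powr (- s)"
        using \<mu> K elim by simp_all
      have "1 / (a (k ^ D) * \<mu> ^ k) \<le> 1 / (K / 2 * real k powr (- s) * \<mu> ^ k)"
        using elim pos K by (intro divide_left_mono mult_right_mono mult_pos_pos) auto
      also have "\<dots> \<le> (real k powr (- 2))\<^sup>2"
      proof -
        have "real k powr (s + 4) = real k powr s * real k ^ 4"
          using elim by (simp add: powr_add)
        then show ?thesis
          using elim pos K by (simp add: powr_minus field_simps)
      qed
      finally show ?case
        using pos elim nonneg K by (auto intro!: real_le_lsqrt)
    qed
  qed
  ultimately show ?thesis
    using D by blast
qed

section \<open>Almost sure convergence of the rescaled quenched tail\<close>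

context GW_moment
begin

abbreviation quenched_env :: "nat \<Rightarrow> (vertex \<Rightarrow> nat) \<Rightarrow> real" where
  "quenched_env n N \<equiv> quenched_tail (1 / \<mu>) (tree_of_offspring N) n"

lemma integral_quenched_env:
  assumes "(\<lambda>T. quenched_tail (1 / \<mu>) T n) \<in> borel_measurable tree_space"
  shows "(\<integral>N. quenched_env n N \<partial>\<Omega>) = annealed_tail p (1 / \<mu>) n"
  unfolding annealed_tail_def GW_law_eq_distr using assms by (subst integral_distr) auto

text \<open>Measurability and positivity are available from \<open>n0\<close> on, hence the shifted
  subsequence: \<open>(j + n0) ^ D\<close> never falls below \<open>n0\<close>.\<close>

lemma AE_quenched_env_tendsto:
  assumes \<gamma>: "0 < \<gamma>" and K: "0 < K"
    and lim: "(\<lambda>n. real n powr \<gamma> * annealed_tail p (1 / \<mu>) n) \<longlonglongrightarrow> K"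
    and meas: "\<And>n. n0 \<le> n \<Longrightarrow> (\<lambda>T. quenched_tail (1 / \<mu>) T n) \<in> borel_measurable tree_space"
    and pos: "\<And>n. n0 \<le> n \<Longrightarrow> 0 < annealed_tail p (1 / \<mu>) n"
  shows "AE N in \<Omega>. (\<lambda>n. real n powr \<gamma> * quenched_env n N) \<longlonglongrightarrow>
    K * GW_limit \<mu> (tree_of_offspring N)"
proof -
  let ?a = "annealed_tail p (1 / \<mu>)"
  have a_nonneg: "0 \<le> ?a n" for n
    unfolding annealed_tail_def by (intro Bochner_Integration.integral_nonneg quenched_tail_nonneg)
  obtain D where D: "0 < D" and sum1: "summable (\<lambda>k. k * ?a (k ^ D) powr (\<beta> - 1))"
    and sum2: "summable (\<lambda>k. sqrt (1 / (?a (k ^ D) * \<mu> ^ k)))"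
    using polynomial_subsequence_summable[OF \<gamma> _ supercritical K a_nonneg lim, of "\<beta> - 1"] beta by auto
  define X where "X k N = quenched_env (k ^ D) N / ?a (k ^ D) - W k N" for k N
  have n0_le: "n0 \<le> (j + n0) ^ D" for j
    using self_le_power[of "j + n0" D] D by (cases "j + n0 = 0") auto
  have quenched [measurable]: "quenched_env ((j + n0) ^ D) \<in> borel_measurable \<Omega>" for j
    using measurable_compose[OF measurable_tree_of_offspring' meas[OF n0_le]] by simp
  have a_eq: "(\<integral>N. quenched_env ((j + n0) ^ D) N \<partial>\<Omega>) = ?a ((j + n0) ^ D)" for j
    by (intro integral_quenched_env meas n0_le)
  have int: "integrable \<Omega> (X (j + n0))" for j
    unfolding X_def[abs_def]
    by (intro Bochner_Integration.integrable_diff integrable_divide integrable_W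
        integrable_const_bound[where B = 1]) (auto simp: quenched_tail_nonneg quenched_tail_le_1)
  have X_le: "(\<integral>N. \<bar>X (j + n0) N\<bar> \<partial>\<Omega>) \<le>
      2 * normalized_moment * (real (j + n0) * ?a ((j + n0) ^ D) powr (\<beta> - 1)) +
        sqrt (1 / (?a ((j + n0) ^ D) * \<mu> ^ (j + n0)))" for j
    unfolding X_def a_eq[symmetric]
  proof (rule integral_abs_normalized_diff_le)
    show "0 < (\<integral>N. quenched_env ((j + n0) ^ D) N \<partial>\<Omega>)"
      unfolding a_eq by (intro pos n0_le)
    show "1 - (\<Prod>i<N []. 1 - quenched_env ((j + n0) ^ D) (subtree_offspring i N) / \<mu>)
        \<le> quenched_env ((j + n0) ^ D) N" for N
      using quenched_tail_tree_ge[of "1 / \<mu>" N "(j + n0) ^ D"] supercritical by simp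
  qed (auto simp: quenched_tail_nonneg quenched_tail_le_1)
  have "summable (\<lambda>j. \<integral>N. \<bar>X (j + n0) N\<bar> \<partial>\<Omega>)"
  proof (rule summable_comparison_test')
    show "summable (\<lambda>j. 2 * normalized_moment * (real (j + n0) * ?a ((j + n0) ^ D) powr (\<beta> - 1)) +
        sqrt (1 / (?a ((j + n0) ^ D) * \<mu> ^ (j + n0))))"
      by (intro summable_add summable_mult summable_ignore_initial_segment[OF sum1]
          summable_ignore_initial_segment[OF sum2])
  qed (use X_le in simp)
  then have "AE N in \<Omega>. summable (\<lambda>j. \<bar>X (j + n0) N\<bar>)"
    by (intro AE_summable_of_summable_integral_abs int)
  then show ?thesis
    using AE_convergent_W
  proof eventually_elim
    case (elim N)
    let ?w = "GW_limit \<mu> (tree_of_offspring N)"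
    have "(\<lambda>j. X (j + n0) N) \<longlonglongrightarrow> 0"
      using summable_LIMSEQ_zero[OF summable_rabs_cancel[OF elim(1)]] .
    then have X: "(\<lambda>k. X k N) \<longlonglongrightarrow> 0"
      by (rule LIMSEQ_offset)
    have "(\<lambda>m. real (card (generation (tree_of_offspring N) m)) / \<mu> ^ m) = (\<lambda>m. W m N)"
      using card_generation_tree[of \<mu> N] supercritical by auto
    then have "(\<lambda>k. W k N) \<longlonglongrightarrow> ?w"
      using elim(2) by (simp add: GW_limit_def convergent_LIMSEQ_iff)
    from tendsto_add[OF X this]
    have "(\<lambda>k. quenched_env (k ^ D) N / ?a (k ^ D)) \<longlonglongrightarrow> ?w"
      by (simp add: X_def)
    moreover have pow_at_top: "filterlim (\<lambda>k. k ^ D) at_top sequentially"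
      by (rule filterlim_power_nat_at_top[OF D])
    then have "(\<lambda>k. real (k ^ D) powr \<gamma> * ?a (k ^ D)) \<longlonglongrightarrow> K"
      by (rule filterlim_compose[OF lim])
    ultimately have prod: "(\<lambda>k. real (k ^ D) powr \<gamma> * ?a (k ^ D) *
        (quenched_env (k ^ D) N / ?a (k ^ D))) \<longlonglongrightarrow> K * ?w"
      by (intro tendsto_mult)
    \<comment> \<open>From here on the annealed tail is nonzero and cancels.\<close>
    have "\<forall>\<^sub>F k in sequentially. n0 \<le> k ^ D"
      using pow_at_top by (simp add: filterlim_at_top)
    then have "(\<lambda>k. real (k ^ D) powr \<gamma> * quenched_env (k ^ D) N) \<longlonglongrightarrow> K * ?w"
      by (intro Lim_transform_eventually[OF prod]) (auto elim!: eventually_mono dest!: pos)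
    then show ?case
      using \<gamma> by (intro tendsto_of_polynomial_subsequence[OF D])
        (auto intro: quenched_tail_nonneg quenched_tail_antimono)
  qed
qed

end

theorem theorem1p3:
  fixes p :: "nat pmf" and \<alpha> \<mu> K :: real
  assumes "1 < \<alpha>" and "\<alpha> \<le> 2"
    and "0 \<notin> set_pmf p"
    and "integrable (measure_pmf p) real"
    and "\<mu> = offspring_mean p" and "1 < \<mu>"
    and "offspring_in_class \<alpha> p"
    and "0 < K"
    and "(\<lambda>n. real n powr (1 / \<alpha>) * annealed_tail p (1 / \<mu>) n) \<longlonglongrightarrow> K"
  shows "AE T in GW_law p.
    (\<lambda>n. real n powr (1 / \<alpha>) * quenched_tail (1 / \<mu>) T n) \<longlonglongrightarrow> K * GW_limit \<mu> T"
proof -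
  obtain \<beta> where \<beta>: "1 < \<beta>" "\<beta> \<le> 2" "integrable (measure_pmf p) (\<lambda>k. real k powr \<beta>)"
    using offspring_in_class_moment assms by blast
  interpret GW_moment p \<mu> \<beta>
    using assms \<beta> by unfold_locales auto
  \<comment> \<open>The positive limit \<open>K\<close> yields the threshold beyond which the
    annealed tail does not vanish.\<close>
  have "\<forall>\<^sub>F n in sequentially. 0 < real n powr (1 / \<alpha>) * annealed_tail p (1 / \<mu>) n"
    using assms by (intro order_tendstoD)
  then obtain n0 where "\<And>n. n0 \<le> n \<Longrightarrow> 0 < real n powr (1 / \<alpha>) * annealed_tail p (1 / \<mu>) n"
    by (auto simp: eventually_sequentially)
  then have pos: "0 < annealed_tail p (1 / \<mu>) n" if "n0 \<le> n" for n
    using that by (auto simp: zero_less_mult_iff)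
  \<comment> \<open>A Bochner integral of a nonmeasurable function is 0, so \<open>pos\<close> yields measurability.\<close>
  have meas: "(\<lambda>T. quenched_tail (1 / \<mu>) T n) \<in> borel_measurable tree_space" if "n0 \<le> n" for n
  proof -
    have "integrable (GW_law p) (\<lambda>T. quenched_tail (1 / \<mu>) T n)"
      using pos[OF that] by (rule_tac ccontr) (simp add: annealed_tail_def not_integrable_integral_eq)
    from borel_measurable_integrable[OF this] show ?thesis
      by (simp add: GW_law_eq_distr)
  qed
  let ?P = "\<lambda>T. (\<lambda>n. real n powr (1 / \<alpha>) * quenched_tail (1 / \<mu>) T n) \<longlonglongrightarrow> K * GW_limit \<mu> T"
  \<comment> \<open>Dropping the first \<open>n0\<close> terms keeps the limit and leaves an event
    built from measurable functions, as \<open>AE_distr_iff\<close> requires.\<close>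
  have "?P T \<longleftrightarrow> (\<lambda>n. real (n + n0) powr (1 / \<alpha>) * quenched_tail (1 / \<mu>) T (n + n0)) \<longlonglongrightarrow>
      K * GW_limit \<mu> T" for T
    using LIMSEQ_ignore_initial_segment[of "\<lambda>n. real n powr (1 / \<alpha>) * quenched_tail (1 / \<mu>) T n" _ n0]
      LIMSEQ_offset[of "\<lambda>n. real n powr (1 / \<alpha>) * quenched_tail (1 / \<mu>) T n" n0] by blast
  moreover have "{T \<in> space tree_space. (\<lambda>n. real (n + n0) powr (1 / \<alpha>) *
      quenched_tail (1 / \<mu>) T (n + n0)) \<longlonglongrightarrow> K * GW_limit \<mu> T} \<in> sets tree_space"
    using meas by (intro sets_tendsto borel_measurable_times) auto
  ultimately have "{T \<in> space tree_space. ?P T} \<in> sets tree_space"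
    by simp
  then have "(AE T in GW_law p. ?P T) \<longleftrightarrow> (AE N in \<Omega>. ?P (tree_of_offspring N))"
    unfolding GW_law_eq_distr by (intro AE_distr_iff) auto
  then show ?thesis
    using AE_quenched_env_tendsto[of "1 / \<alpha>" K n0] assms pos meas by simp
qed

end
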